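(* For every $n\in\omega$: if every $\Delta^1_n$ set of reals is Lebesgue measurable, then $\Delta^1_n(\mathcal{PFS})$ holds. Furthermore, if every $\Sigma^1_n$ set of reals is Lebesgue measurable, then every function $f:(\omega^\omega)^m\to\omega^\omega$ ($m\ge1$) whose graph $\{(x,f(x)):x\in(\omega^\omega)^m\}$ is a $\Pi^1_n$ set has a perfect free subset.
   Context: All projective classes are boldface. For a function $f:X^m\to X$ (with $X=2^\omega$ or $\omega^\omega$), a set $A\subseteq X$ is free for $f$ if for all $(a_0,\dots,a_{m-1})\in A^m$ we have $f(a_0,\dots,a_{m-1})\in\{a_0,\dots,a_{m-1}\}\cup(X\setminus A)$; a perfect free subset is a nonempty closed set without isolated points which is free for $f$. A function is a $\Delta^1_n$-function if preimages of open sets are $\Delta^1_n$. $\Delta^1_n(\mathcal{PFS})$ means: for every $m\ge1$, every $\Delta^1_n$-function $f:(2^\omega)^m\to 2^\omega$ has a perfect free subset. *)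

theory Defs
  imports "HOL-Analysis.Analysis"
begin

text \<open>Baire space is nat \<Rightarrow> nat, Cantor space is nat \<Rightarrow> bool, both with the
product topology (library instance for function types; nat and bool are discrete).
m-fold products are 'm \<Rightarrow> X for a finite index type 'm.\<close>

text \<open>Boldface projective pointclasses on Baire space:
  baire_Pi 0 = closed sets (Pi^0_1),
  baire_Pi (Suc k) = Pi^1_(k+1) = complements of continuous images of baire_Pi k sets.\<close>
fun baire_Pi :: "nat \<Rightarrow> (nat \<Rightarrow> nat) set set" where
  "baire_Pi 0 = {C. closed C}"
| "baire_Pi (Suc k) =
     {- (g ` B) | (g :: (nat \<Rightarrow> nat) \<Rightarrow> (nat \<Rightarrow> nat)) B.
         continuous_on UNIV g \<and> B \<in> baire_Pi k}"

text \<open>For n \<ge> 1: a subset of a (Polish) space X is boldface Sigma^1_n iff it is the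
image of a Pi^1_(n-1) subset of Baire space under a continuous map (Pi^1_0 = closed).\<close>
definition boldSigma :: "nat \<Rightarrow> 'a::topological_space set set" where
  "boldSigma n = {g ` B | (g :: (nat \<Rightarrow> nat) \<Rightarrow> 'a) B.
                     continuous_on UNIV g \<and> B \<in> baire_Pi (n - 1)}"

definition boldPi :: "nat \<Rightarrow> 'a::topological_space set set" where
  "boldPi n = {A. - A \<in> boldSigma n}"

definition boldDelta :: "nat \<Rightarrow> 'a::topological_space set set" where
  "boldDelta n = boldSigma n \<inter> boldPi n"

definition Delta_function :: "nat \<Rightarrow> ('a::topological_space \<Rightarrow> 'b::topological_space) \<Rightarrow> bool" where
  "Delta_function n f \<longleftrightarrow> (\<forall>U. open U \<longrightarrow> f -` U \<in> boldDelta n)"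

definition free_for :: "(('m \<Rightarrow> 'a) \<Rightarrow> 'a) \<Rightarrow> 'a set \<Rightarrow> bool" where
  "free_for f A \<longleftrightarrow>
     (\<forall>a. (\<forall>i. a i \<in> A) \<longrightarrow> f a \<in> range a \<union> (- A))"

definition has_perfect_free_subset :: "(('m \<Rightarrow> 'a::topological_space) \<Rightarrow> 'a) \<Rightarrow> bool" where
  "has_perfect_free_subset f \<longleftrightarrow>
     (\<exists>P. P \<noteq> {} \<and> closed P \<and> (\<forall>x\<in>P. x islimpt P) \<and> free_for f P)"

end

theory Submission
  imports Defs
begin

text \<open>Measurability of sets of reals transfers to the Cantor space with the coin-tossing measure
  through binary expansions. The graph of \<open>f\<close>, and of every map obtained from \<open>f\<close> by
  identifying or permuting arguments, is then a measurable set of tuples; it is null because the bit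
  flips of the dependent coordinate move it to infinitely many disjoint sets of equal measure. By
  Mycielski's theorem a null set of tuples is avoided by all injective tuples from some perfect set
  \<open>P\<close>. If \<open>f a \<in> P\<close> were not a component of a tuple \<open>a\<close> from \<open>P\<close>, extend the distinct entries
  of \<open>a\<close> to an injective tuple that omits \<open>f a\<close>: together with \<open>f a\<close> it would lie on one of these
  graphs. For the Baire space the same argument is applied inside its closed subset of 0-1
  sequences.

  For Mycielski's theorem the perfect set is a random tree: position \<open>p\<close> of the branch indexed by
  \<open>t\<close> is a random bit attached to \<open>p\<close> and the first \<open>\<kappa> p\<close> entries of \<open>t\<close>. A null set is contained
  in the upper limit of cylinders with summable measures, and if \<open>\<kappa>\<close> grows slowly enough, a union
  bound over the nodes shows that with positive probability every injective tuple of branches meets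
  only finitely many of these cylinders.\<close>

section \<open>Projective sets\<close>

lemma hausdorff_fun:
  fixes f g :: "'a \<Rightarrow> 'b::t2_space"
  assumes "f \<noteq> g"
  shows "\<exists>U V. open U \<and> open V \<and> f \<in> U \<and> g \<in> V \<and> U \<inter> V = {}"
proof -
  obtain i where "f i \<noteq> g i" using assms by blast
  then obtain U V where UV: "open U" "open V" "f i \<in> U" "g i \<in> V" "U \<inter> V = {}"
    using hausdorff by metis
  have "open ((\<lambda>h. h i) -` W)" if "open W" for W :: "'b set"
    using that by (intro open_vimage) auto
  with UV show ?thesis
    by (intro exI[of _ "(\<lambda>h. h i) -` U"] exI[of _ "(\<lambda>h. h i) -` V"]) auto
qed

text \<open>The weaker classes come first: the arities from metric spaces would clash with a bare
  \<open>t2_space\<close> instance.\<close>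

instance "fun" :: (type, t2_space) t0_space
  by standard (metis hausdorff_fun disjoint_iff)

instance "fun" :: (type, t2_space) t1_space
  by standard (metis hausdorff_fun disjoint_iff)

instance "fun" :: (type, t2_space) t2_space
  by standard (rule hausdorff_fun)

definition cyl :: "nat \<Rightarrow> (nat \<Rightarrow> 'a) \<Rightarrow> (nat \<Rightarrow> 'a) set" where
  "cyl k v = {w. \<forall>n<k. w n = v n}"

lemma open_cyl: "open (cyl k (v :: nat \<Rightarrow> 'a::discrete_topology))"
proof -
  have "cyl k v = (\<Inter>n\<in>{..<k}. (\<lambda>w. w n) -` {v n})"
    by (auto simp: cyl_def)
  moreover have "open ((\<lambda>w :: nat \<Rightarrow> 'a. w n) -` {v n})" for n
    by (intro open_vimage) (auto simp: open_discrete)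
  ultimately show ?thesis by auto
qed

text \<open>A basic open set of the product restricts only finitely many coordinates, so agreement
  on a prefix reaching beyond all of them suffices.\<close>

lemma open_contains_cyl:
  fixes U :: "(nat \<Rightarrow> 'a::topological_space) set"
  assumes "open U" "x \<in> U"
  obtains k where "cyl k x \<subseteq> U"
proof -
  from assms obtain X where X: "x \<in> (\<Pi>\<^sub>E i\<in>UNIV. X i)" "finite {i. X i \<noteq> UNIV}" "(\<Pi>\<^sub>E i\<in>UNIV. X i) \<subseteq> U"
    unfolding open_fun_def using product_topology_open_contains_basis[of "\<lambda>_. euclidean" UNIV U x]
    by auto
  \<comment> \<open>\<open>insert 0\<close> keeps \<open>Max\<close> meaningful when no coordinate
    is restricted.\<close>
  define k where "k = Suc (Max (insert 0 {i. X i \<noteq> UNIV}))"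
  have "n < k" if "X n \<noteq> UNIV" for n
    using that X(2) unfolding k_def less_Suc_eq_le by (intro Max_ge) auto
  then have "cyl k x \<subseteq> (\<Pi>\<^sub>E i\<in>UNIV. X i)"
    using X(1) unfolding cyl_def PiE_UNIV_domain Pi_iff by fastforce
  from this X(3) have "cyl k x \<subseteq> U" by (rule order_trans)
  then show ?thesis by (rule that)
qed

lemma openI_cyl:
  fixes U :: "(nat \<Rightarrow> 'a::discrete_topology) set"
  assumes "\<And>x. x \<in> U \<Longrightarrow> \<exists>k. cyl k x \<subseteq> U"
  shows "open U"
proof -
  obtain k where k: "\<And>x. x \<in> U \<Longrightarrow> cyl (k x) x \<subseteq> U"
    using assms by metis
  then have eq: "(\<Union>x\<in>U. cyl (k x) x) = U"
    by (auto simp: cyl_def)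
  have "open (\<Union>x\<in>U. cyl (k x) x)"
    by (intro open_UN ballI open_cyl)
  then show ?thesis
    unfolding eq .
qed

lemma continuous_reindex: "continuous_on UNIV (\<lambda>w i. w (r i) :: 'a::topological_space)"
  by (intro continuous_on_coordinatewise_then_product) auto

section \<open>Closure properties of the projective classes\<close>

abbreviation (input) evens :: "(nat \<Rightarrow> 'a) \<Rightarrow> nat \<Rightarrow> 'a" where "evens w \<equiv> \<lambda>n. w (2 * n)"
abbreviation (input) odds :: "(nat \<Rightarrow> 'a) \<Rightarrow> nat \<Rightarrow> 'a" where "odds w \<equiv> \<lambda>n. w (Suc (2 * n))"
abbreviation (input) tail :: "(nat \<Rightarrow> 'a) \<Rightarrow> nat \<Rightarrow> 'a" where "tail w \<equiv> \<lambda>n. w (Suc n)"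

lemma obtain_interleave:
  obtains w where "evens w = x" "odds w = y"
  by (rule that[of "\<lambda>n. if even n then x (n div 2) else y (n div 2)"]) auto

text \<open>The induction invariant: these properties of a class make the class of its continuous
  images closed under finite unions, finite intersections and continuous preimages.\<close>

definition adequate_pointclass :: "(nat \<Rightarrow> nat) set set \<Rightarrow> bool" where
  "adequate_pointclass K \<longleftrightarrow>
     (\<forall>A\<in>K. \<forall>h. continuous_on UNIV h \<longrightarrow> h -` A \<in> K) \<and>
     (\<forall>A\<in>K. \<forall>B\<in>K. A \<inter> B \<in> K \<and> A \<union> B \<in> K) \<and>
     (\<forall>C. closed C \<longrightarrow> C \<in> K)"

lemma adequate_pointclassD:
  assumes "adequate_pointclass K"
  shows "A \<in> K \<Longrightarrow> continuous_on UNIV h \<Longrightarrow> h -` A \<in> K"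
    and "A \<in> K \<Longrightarrow> B \<in> K \<Longrightarrow> A \<inter> B \<in> K"
    and "A \<in> K \<Longrightarrow> B \<in> K \<Longrightarrow> A \<union> B \<in> K"
    and "closed C \<Longrightarrow> C \<in> K"
  using assms unfolding adequate_pointclass_def by auto

lemma boldSigmaI:
  assumes "continuous_on UNIV g" "B \<in> baire_Pi k" "A = g ` B"
  shows "A \<in> boldSigma (Suc k)"
  using assms unfolding boldSigma_def by auto

lemma boldSigmaE:
  assumes "A \<in> boldSigma (Suc k)"
  obtains g B where "continuous_on UNIV g" "B \<in> baire_Pi k" "A = g ` B"
  using assms unfolding boldSigma_def by auto

lemma boldSigma_image:
  assumes "A \<in> boldSigma n" "continuous_on UNIV h"
  shows "h ` A \<in> boldSigma n"
proof -
  obtain g B where gB: "continuous_on UNIV g" "B \<in> baire_Pi (n - 1)" "A = g ` B"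
    using assms(1) unfolding boldSigma_def by auto
  have "continuous_on UNIV (h \<circ> g)"
    using gB(1) assms(2) continuous_on_compose continuous_on_subset by blast
  with gB(2,3) show ?thesis
    unfolding boldSigma_def by (auto simp: image_comp intro!: exI[of _ "h \<circ> g"] exI[of _ B])
qed

lemma closed_coordinate_0: "closed {w :: nat \<Rightarrow> nat. w 0 \<in> S}"
proof -
  have "{w :: nat \<Rightarrow> nat. w 0 \<in> S} = (\<lambda>w. w 0) -` S" by auto
  then show ?thesis
    by (auto intro!: closed_vimage simp: closed_def open_discrete)
qed

text \<open>The first entry of a code selects which of the two parametrisations is applied to the
  rest of the code.\<close>

lemma boldSigma_Un_aux:
  assumes K: "adequate_pointclass (baire_Pi k)"
    and "A \<in> boldSigma (Suc k)" "B \<in> boldSigma (Suc k)"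
  shows "A \<union> B \<in> boldSigma (Suc k)"
proof -
  obtain g C where g: "continuous_on UNIV g" "C \<in> baire_Pi k" "A = g ` C"
    using assms(2) by (rule boldSigmaE)
  obtain h D where h: "continuous_on UNIV h" "D \<in> baire_Pi k" "B = h ` D"
    using assms(3) by (rule boldSigmaE)
  define f where "f = (\<lambda>w. if w \<in> {w. w 0 \<in> {0::nat}} then g (tail w) else h (tail w))"
  define E where "E = (tail -` C \<inter> {w. w 0 \<in> {0}}) \<union> (tail -` D \<inter> {w. w 0 \<in> - {0}})"
  have gt: "continuous_on S (\<lambda>w. g (tail w))" for S
    using continuous_on_compose2[OF g(1) continuous_reindex[of Suc]] continuous_on_subset by blast
  have ht: "continuous_on S (\<lambda>w. h (tail w))" for S
    using continuous_on_compose2[OF h(1) continuous_reindex[of Suc]] continuous_on_subset by blast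
  have "continuous_on ({w. w 0 \<in> {0}} \<union> {w. w 0 \<in> - {0}}) f"
    unfolding f_def by (rule continuous_on_If[OF closed_coordinate_0 closed_coordinate_0 gt ht]) auto
  moreover have "{w. w 0 \<in> {0}} \<union> {w. w 0 \<in> - {0::nat}} = UNIV" by auto
  ultimately have "continuous_on UNIV f" by metis
  moreover have "E \<in> baire_Pi k"
    unfolding E_def
    by (intro adequate_pointclassD(1)[OF K] adequate_pointclassD(2)[OF K] adequate_pointclassD(3)[OF K] adequate_pointclassD(4)[OF K]
        closed_coordinate_0 g h continuous_reindex)
  moreover have "A \<union> B = f ` E"
  proof -
    have "g x \<in> f ` E" if "x \<in> C" for x
      by (rule image_eqI[of _ _ "case_nat 0 x"]) (use that in \<open>auto simp: f_def E_def\<close>)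
    moreover have "h x \<in> f ` E" if "x \<in> D" for x
      by (rule image_eqI[of _ _ "case_nat 1 x"]) (use that in \<open>auto simp: f_def E_def\<close>)
    moreover have "f w \<in> g ` C \<union> h ` D" if "w \<in> E" for w
      using that by (auto simp: f_def E_def)
    ultimately show ?thesis
      unfolding g(3) h(3) by blast
  qed
  ultimately show ?thesis by (rule boldSigmaI)
qed

lemma continuous_on_compose_UNIV:
  assumes "continuous_on UNIV g" "continuous_on UNIV h"
  shows "continuous_on UNIV (\<lambda>x. g (h x))"
  using continuous_on_compose2[OF assms] by auto

text \<open>A code interleaves a code of a point of \<open>A\<close> with a code of a point of
  \<open>B\<close>. That both name the same point is a closed condition, since the target space is
  Hausdorff.\<close>

lemma boldSigma_Int_aux:
  fixes A B :: "'a::t2_space set"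
  assumes K: "adequate_pointclass (baire_Pi k)"
    and "A \<in> boldSigma (Suc k)" "B \<in> boldSigma (Suc k)"
  shows "A \<inter> B \<in> boldSigma (Suc k)"
proof -
  obtain g C where g: "continuous_on UNIV g" "C \<in> baire_Pi k" "A = g ` C"
    using assms(2) by (rule boldSigmaE)
  obtain h D where h: "continuous_on UNIV h" "D \<in> baire_Pi k" "B = h ` D"
    using assms(3) by (rule boldSigmaE)
  have ge: "continuous_on UNIV (\<lambda>w. g (evens w))" and ho: "continuous_on UNIV (\<lambda>w. h (odds w))"
    using continuous_on_compose_UNIV continuous_reindex g(1) h(1) by blast+
  define E where "E = (evens -` C \<inter> odds -` D) \<inter> {w. g (evens w) = h (odds w)}"
  have "E \<in> baire_Pi k"
    unfolding E_def
    by (intro adequate_pointclassD(1)[OF K] adequate_pointclassD(2)[OF K] adequate_pointclassD(4)[OF K]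
        closed_Collect_eq ge ho g h continuous_reindex)
  moreover have "A \<inter> B = (\<lambda>w. g (evens w)) ` E"
  proof (intro equalityI subsetI)
    fix a assume "a \<in> A \<inter> B"
    then obtain x y where xy: "x \<in> C" "a = g x" "y \<in> D" "a = h y"
      using g(3) h(3) by auto
    obtain w where "evens w = x" "odds w = y" by (rule obtain_interleave)
    with xy show "a \<in> (\<lambda>w. g (evens w)) ` E"
      by (intro image_eqI[of _ _ w]) (auto simp: E_def)
  next
    fix a assume "a \<in> (\<lambda>w. g (evens w)) ` E"
    then obtain w where "evens w \<in> C" "odds w \<in> D" "g (evens w) = h (odds w)" "a = g (evens w)"
      unfolding E_def by auto
    then show "a \<in> A \<inter> B"
      unfolding g(3) h(3) by (metis IntI imageI)
  qed
  ultimately show ?thesis using ge by (intro boldSigmaI)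
qed

text \<open>The map \<open>p\<close> parametrises the domain of \<open>h\<close>. The even entries
  of a code name a point, the odd entries a witness that its value under \<open>h\<close> lies in
  \<open>A\<close>.\<close>

lemma boldSigma_vimage_aux:
  fixes A :: "'a::t2_space set" and h :: "'b::topological_space \<Rightarrow> 'a"
  assumes K: "adequate_pointclass (baire_Pi k)"
    and A: "A \<in> boldSigma (Suc k)" and h: "continuous_on UNIV h"
    and p: "continuous_on UNIV (p :: (nat \<Rightarrow> nat) \<Rightarrow> 'b)" "surj p"
  shows "h -` A \<in> boldSigma (Suc k)"
proof -
  obtain g C where g: "continuous_on UNIV g" "C \<in> baire_Pi k" "A = g ` C"
    using A by (rule boldSigmaE)
  have go: "continuous_on UNIV (\<lambda>w. g (odds w))" and pe: "continuous_on UNIV (\<lambda>w. p (evens w))"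
    using continuous_on_compose_UNIV continuous_reindex g(1) p(1) by blast+
  have hpe: "continuous_on UNIV (\<lambda>w. h (p (evens w)))"
    using continuous_on_compose_UNIV[OF h pe] .
  define E where "E = odds -` C \<inter> {w. g (odds w) = h (p (evens w))}"
  have "E \<in> baire_Pi k"
    unfolding E_def
    by (intro adequate_pointclassD(1)[OF K] adequate_pointclassD(2)[OF K] adequate_pointclassD(4)[OF K]
        closed_Collect_eq go hpe g continuous_reindex)
  moreover have "h -` A = (\<lambda>w. p (evens w)) ` E"
  proof (intro equalityI subsetI)
    fix a assume "a \<in> h -` A"
    then obtain y where y: "y \<in> C" "h a = g y"
      using g(3) by auto
    obtain x where x: "a = p x" using p(2) by auto
    obtain w where "evens w = x" "odds w = y" by (rule obtain_interleave)
    with x y show "a \<in> (\<lambda>w. p (evens w)) ` E"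
      by (intro image_eqI[of _ _ w]) (auto simp: E_def)
  next
    fix a assume "a \<in> (\<lambda>w. p (evens w)) ` E"
    then obtain w where w: "odds w \<in> C" "g (odds w) = h (p (evens w))" "a = p (evens w)"
      unfolding E_def by auto
    then have "h a = g (odds w)" by simp
    then show "a \<in> h -` A" unfolding g(3) using w(1) by blast
  qed
  ultimately show ?thesis using pe by (intro boldSigmaI)
qed

text \<open>An open set \<open>U\<close> is the tail projection of the clopen set of all \<open>w\<close> whose first entry
  witnesses \<open>cyl (w 0) (tail w) \<subseteq> U\<close>.\<close>

lemma open_baire_boldSigma:
  fixes U :: "(nat \<Rightarrow> nat) set"
  assumes clopen: "\<And>C. closed C \<Longrightarrow> open C \<Longrightarrow> C \<in> baire_Pi k" and U: "open U"
  shows "U \<in> boldSigma (Suc k)"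
proof -
  define E where "E = {w. cyl (w 0) (tail w) \<subseteq> U}"
  \<comment> \<open>The condition reads \<open>w\<close> up to and including index
    \<open>w 0\<close>, whence the \<open>Suc\<close>. A finite prefix thus decides membership,
    which makes \<open>E\<close> clopen.\<close>
  have E: "w \<in> E \<longleftrightarrow> v \<in> E" if "v \<in> cyl (Suc (w 0)) w" for v w
    using that by (auto simp: E_def cyl_def)
  have "open E"
    by (rule openI_cyl) (use E in blast)
  moreover have "open (- E)"
    by (rule openI_cyl) (use E in blast)
  ultimately have "E \<in> baire_Pi k"
    by (intro clopen) (auto simp: closed_def)
  moreover have "U = tail ` E"
  proof (intro equalityI subsetI)
    fix x assume "x \<in> U"
    then obtain m where "cyl m x \<subseteq> U" using U open_contains_cyl by blast
    then show "x \<in> tail ` E"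
      by (intro image_eqI[of _ _ "case_nat m x"]) (auto simp: E_def)
  next
    fix x assume "x \<in> tail ` E"
    then show "x \<in> U" by (auto simp: E_def cyl_def)
  qed
  ultimately show ?thesis using continuous_reindex by (intro boldSigmaI)
qed

lemma baire_Pi_Suc_iff: "A \<in> baire_Pi (Suc k) \<longleftrightarrow> - A \<in> boldSigma (Suc k)"
proof -
  have "A \<in> baire_Pi (Suc k) \<longleftrightarrow> (\<exists>S\<in>boldSigma (Suc k). A = - S)"
    unfolding boldSigma_def by auto
  then show ?thesis by auto
qed

text \<open>The identity map and the stability of clopen sets under complement carry them from each
  level to the next.\<close>

lemma clopen_baire_Pi: "closed C \<Longrightarrow> open C \<Longrightarrow> C \<in> baire_Pi k"
proof (induction k arbitrary: C)
  case (Suc k)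
  then have "- C \<in> baire_Pi k" by blast
  then have "- C \<in> boldSigma (Suc k)"
    by (intro boldSigmaI[of id "- C"]) (auto simp: id_def)
  then show ?case by (simp only: baire_Pi_Suc_iff)
qed simp

lemma adequate_baire_Pi: "adequate_pointclass (baire_Pi k)"
proof (induction k)
  case 0
  show ?case
    unfolding adequate_pointclass_def by (auto intro: closed_vimage)
next
  case (Suc k)
  note IH = Suc.IH
  have "h -` A \<in> baire_Pi (Suc k)" if "A \<in> baire_Pi (Suc k)" "continuous_on UNIV h" for A h
    using boldSigma_vimage_aux[OF IH, of "- A" h id] that
    by (simp only: baire_Pi_Suc_iff) (auto simp: vimage_Compl id_def)
  moreover have "A \<inter> B \<in> baire_Pi (Suc k) \<and> A \<union> B \<in> baire_Pi (Suc k)"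
    if "A \<in> baire_Pi (Suc k)" "B \<in> baire_Pi (Suc k)" for A B
    using that boldSigma_Un_aux[OF IH, of "- A" "- B"] boldSigma_Int_aux[OF IH, of "- A" "- B"]
    by (simp only: baire_Pi_Suc_iff Compl_Int Compl_Un)
  \<comment> \<open>Closed sets enter the new level by \<open>open_baire_boldSigma\<close>, with
    only clopen sets taken from the level below.\<close>
  moreover have "C \<in> baire_Pi (Suc k)" if "closed C" for C
    using that open_baire_boldSigma[OF clopen_baire_Pi, of "- C"]
    by (simp only: baire_Pi_Suc_iff open_Compl)
  ultimately show ?case
    unfolding adequate_pointclass_def by simp
qed

lemmas boldSigma_Un = boldSigma_Un_aux[OF adequate_baire_Pi]
lemmas boldSigma_Int = boldSigma_Int_aux[OF adequate_baire_Pi]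
lemmas boldSigma_vimage = boldSigma_vimage_aux[OF adequate_baire_Pi]

lemma closed_image_boldSigma:
  fixes C :: "(nat \<Rightarrow> nat) set"
  assumes "closed C" "continuous_on UNIV g"
  shows "g ` C \<in> boldSigma (Suc k)"
  using assms(2) adequate_pointclassD(4)[OF adequate_baire_Pi assms(1)] refl by (rule boldSigmaI)

section \<open>Binary expansions and the coin-tossing measure\<close>

definition binval :: "(nat \<Rightarrow> bool) \<Rightarrow> real" where
  "binval y = (\<Sum>i. of_bool (y i) * (1/2) ^ Suc i)"

text \<open>Dyadic rationals receive the expansion that ends in zeros. The integer part is lost, so
  \<open>[0, 1)\<close> is the domain on which \<open>binval\<close> inverts this map.\<close>

definition bindigits :: "real \<Rightarrow> nat \<Rightarrow> bool" where
  "bindigits x i = odd \<lfloor>2 ^ Suc i * x\<rfloor>"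

text \<open>The first \<open>k\<close> bits read as a binary integer;
  \<open>binnum k v / 2 ^ k\<close> is the left endpoint of the dyadic interval belonging to
  \<open>cyl k v\<close>.\<close>

fun binnum :: "nat \<Rightarrow> (nat \<Rightarrow> bool) \<Rightarrow> int" where
  "binnum 0 v = 0"
| "binnum (Suc k) v = 2 * binnum k v + of_bool (v k)"

lemma binnum_cong: "w \<in> cyl k v \<Longrightarrow> binnum k w = binnum k v"
  by (induction k) (auto simp: cyl_def)

lemma floor_double: "\<lfloor>2 * x :: real\<rfloor> = 2 * \<lfloor>x\<rfloor> + of_bool (odd \<lfloor>2 * x\<rfloor>)"
proof -
  have "\<lfloor>2 * x\<rfloor> = 2 * \<lfloor>x\<rfloor> \<or> \<lfloor>2 * x\<rfloor> = 2 * \<lfloor>x\<rfloor> + 1"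
    by linarith
  then show ?thesis by auto
qed

text \<open>Doubling the argument of the floor doubles its value and adds the next digit, which is
  the recursion of \<open>binnum\<close>. At \<open>k = 0\<close> the equation says that the floor
  of \<open>x\<close> is \<open>0\<close>, that is, \<open>0 \<le> x < 1\<close>.\<close>

lemma bindigits_cyl_iff:
  "0 \<le> x \<and> x < 1 \<and> bindigits x \<in> cyl k v \<longleftrightarrow> \<lfloor>2 ^ k * x\<rfloor> = binnum k v"
proof (induction k)
  case 0
  show ?case by (simp add: cyl_def floor_eq_iff)
next
  case (Suc k)
  have "bindigits x \<in> cyl (Suc k) v \<longleftrightarrow> bindigits x \<in> cyl k v \<and> odd \<lfloor>2 ^ Suc k * x\<rfloor> = v k"
    by (auto simp: cyl_def bindigits_def less_Suc_eq)
  moreover have "\<lfloor>2 ^ Suc k * x\<rfloor> = 2 * \<lfloor>2 ^ k * x\<rfloor> + of_bool (odd \<lfloor>2 ^ Suc k * x\<rfloor>)"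
    using floor_double[of "2 ^ k * x"] by (simp add: mult.assoc)
  ultimately show ?case
    using Suc.IH by (cases "v k"; cases "odd \<lfloor>2 ^ Suc k * x\<rfloor>") (simp_all, presburger+)
qed

lemma summable_binval: "summable (\<lambda>i. of_bool (y i) * (1/2 :: real) ^ Suc i)"
  by (rule summable_comparison_test[of _ "\<lambda>i. (1/2) ^ Suc i"]) (auto simp: summable_geometric)

lemma binnum_sum: "(\<Sum>i<k. of_bool (y i) * (1/2 :: real) ^ Suc i) = binnum k y / 2 ^ k"
  by (induction k) (auto simp: field_simps power_one_over)

text \<open>The bits from \<open>k\<close> on contribute at least \<open>0\<close> and at most
  \<open>1 / 2 ^ k\<close>.\<close>

lemma binval_bounds:
  "binnum k y / 2 ^ k \<le> binval y" "binval y \<le> (binnum k y + 1) / 2 ^ k"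
proof -
  let ?f = "\<lambda>i. of_bool (y i) * (1/2 :: real) ^ Suc i"
  have split: "binval y = (\<Sum>i. ?f (i + k)) + binnum k y / 2 ^ k"
    unfolding binval_def binnum_sum[symmetric] by (rule suminf_split_initial_segment[OF summable_binval])
  have sm: "summable (\<lambda>i. ?f (i + k))"
    by (rule summable_ignore_initial_segment[OF summable_binval])
  have "0 \<le> (\<Sum>i. ?f (i + k))"
    by (rule suminf_nonneg[OF sm]) auto
  with split show "binnum k y / 2 ^ k \<le> binval y" by simp
  have g: "(\<lambda>i. (1/2 :: real) ^ k * (1/2) ^ Suc i) sums ((1/2) ^ k * 1)"
    by (intro sums_mult power_half_series)
  have "(\<Sum>i. ?f (i + k)) \<le> (\<Sum>i. (1/2) ^ k * (1/2) ^ Suc i)"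
    by (rule suminf_le[OF _ sm sums_summable[OF g]]) (auto simp: power_add)
  also have "\<dots> = 1 / 2 ^ k"
    using sums_unique[OF g, symmetric] unfolding power_one_over mult_1_right .
  finally show "binval y \<le> (binnum k y + 1) / 2 ^ k"
    using split by (simp add: add_divide_distrib)
qed

lemma half_power_small: "e > 0 \<Longrightarrow> \<exists>k. 1 / 2 ^ k < (e :: real)"
  using real_arch_pow_inv[of e "1/2"] by (simp add: power_one_over)

text \<open>For every \<open>k\<close> both numbers lie in the same closed dyadic interval of length
  \<open>1 / 2 ^ k\<close>.\<close>

lemma binval_bindigits:
  assumes "0 \<le> x" "x < 1"
  shows "binval (bindigits x) = x"
proof (rule ccontr)
  assume "binval (bindigits x) \<noteq> x"
  then obtain k where k: "1 / 2 ^ k < \<bar>binval (bindigits x) - x\<bar>"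
    using half_power_small[of "\<bar>binval (bindigits x) - x\<bar>"] by auto
  have "\<lfloor>2 ^ k * x\<rfloor> = binnum k (bindigits x)"
    using bindigits_cyl_iff[of x k "bindigits x"] assms by (simp add: cyl_def)
  then have "binnum k (bindigits x) \<le> 2 ^ k * x" "2 ^ k * x < binnum k (bindigits x) + 1"
    by linarith+
  then have "binnum k (bindigits x) / 2 ^ k \<le> x" "x < (binnum k (bindigits x) + 1) / 2 ^ k"
    by (auto simp: field_simps)
  with k binval_bounds[where y = "bindigits x" and k = k] show False
    by (simp add: add_divide_distrib)
qed

lemma continuous_on_cylI:
  fixes f :: "(nat \<Rightarrow> 'a::discrete_topology) \<Rightarrow> 'b::topological_space"
  assumes "\<And>U x. open U \<Longrightarrow> f x \<in> U \<Longrightarrow> \<exists>k. \<forall>w\<in>cyl k x. f w \<in> U"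
  shows "continuous_on UNIV f"
proof -
  have "open (f -` U)" if "open U" for U
    by (rule openI_cyl) (use assms[OF that] in blast)
  then show ?thesis by (simp add: continuous_on_open_vimage)
qed

lemma continuous_binval: "continuous_on UNIV binval"
proof (rule continuous_on_cylI)
  fix U :: "real set" and x
  assume "open U" "binval x \<in> U"
  then obtain e where e: "e > 0" "\<And>y. dist y (binval x) < e \<Longrightarrow> y \<in> U"
    unfolding open_dist by blast
  obtain k where k: "1 / 2 ^ k < e" using half_power_small e(1) by blast
  have "binval w \<in> U" if "w \<in> cyl k x" for w
    using binval_bounds[where k = k and y = w] binval_bounds[where k = k and y = x] binnum_cong[OF that] k
    by (intro e(2)) (simp add: dist_real_def add_divide_distrib)
  then show "\<exists>k. \<forall>w\<in>cyl k x. binval w \<in> U" by blast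
qed

text \<open>At the first difference one sequence has bit 1 and the other bit 0. The lower bound for
  the former meets the upper bound for the latter, so the common value is dyadic. Hence
  \<open>binval\<close> is injective off the rationals.\<close>

lemma binval_eq_cases:
  assumes "binval y = binval a" "y \<noteq> a"
  shows "binval y \<in> \<rat>"
proof -
  define i where "i = (LEAST i. y i \<noteq> a i)"
  have ne: "y i \<noteq> a i"
    using assms(2) LeastI_ex[of "\<lambda>i. y i \<noteq> a i"] unfolding i_def fun_eq_iff by blast
  have "y \<in> cyl i a"
    unfolding cyl_def i_def by (auto dest: not_less_Least)
  then have eq: "binnum i y = binnum i a" by (rule binnum_cong)
  have "binval u \<in> \<rat>" if "binval u = binval v" "u i" "\<not> v i" "binnum i u = binnum i v" for u v
  proof -
    have "binnum (Suc i) u / 2 ^ Suc i \<le> binval u" "binval v \<le> (binnum (Suc i) v + 1) / 2 ^ Suc i"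
      by (rule binval_bounds)+
    with that have "binval u = binnum (Suc i) u / 2 ^ Suc i" by simp
    then show ?thesis by simp
  qed
  from this[of y a] this[of a y] ne eq assms(1) show ?thesis by metis
qed

text \<open>The empty set is added so that the family is stable under intersection.\<close>

definition cylinders :: "(nat \<Rightarrow> bool) set set" where
  "cylinders = insert {} (\<Union>k. range (cyl k))"

lemma cyl_in_cylinders: "cyl k v \<in> cylinders"
  by (auto simp: cylinders_def)

lemma countable_cylinders: "countable cylinders"
proof -
  have "cyl k v = cyl k (\<lambda>n. map v [0..<k] ! n)" for k and v :: "nat \<Rightarrow> bool"
    by (auto simp: cyl_def)
  then have "range (cyl k) \<subseteq> range (\<lambda>u :: bool list. cyl k (\<lambda>n. u ! n))" for k
    by blast
  then have "countable (range (cyl k :: (nat \<Rightarrow> bool) \<Rightarrow> _))" for k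
    by (rule countable_subset) auto
  then show ?thesis by (auto simp: cylinders_def)
qed

text \<open>There are only countably many cylinders, so each open set is a countable union of
  them.\<close>

lemma borel_eq_cylinders: "(borel :: (nat \<Rightarrow> bool) measure) = sigma UNIV cylinders"
  unfolding borel_def
proof (rule sigma_eqI)
  show "sigma_sets UNIV {S. open S} = sigma_sets UNIV cylinders"
  proof (rule sigma_sets_eqI)
    fix U :: "(nat \<Rightarrow> bool) set" assume "U \<in> {S. open S}"
    then have U: "open U" by simp
    have "x \<in> \<Union>{C \<in> cylinders. C \<subseteq> U}" if x: "x \<in> U" for x
    proof -
      obtain k where "cyl k x \<subseteq> U" using open_contains_cyl[OF U x] .
      moreover have "x \<in> cyl k x" by (simp add: cyl_def)
      ultimately show ?thesis using cyl_in_cylinders by blast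
    qed
    then have "U = \<Union>{C \<in> cylinders. C \<subseteq> U}" by blast
    moreover have "\<Union>{C \<in> cylinders. C \<subseteq> U} \<in> sigma_sets UNIV cylinders"
      by (intro sigma_sets_UNION countable_subset[OF _ countable_cylinders]) auto
    ultimately show "U \<in> sigma_sets UNIV cylinders" by simp
  next
    fix C :: "(nat \<Rightarrow> bool) set" assume "C \<in> cylinders"
    then show "C \<in> sigma_sets UNIV {S. open S}"
      by (intro sigma_sets.Basic) (auto simp: cylinders_def open_cyl)
  qed
qed auto

lemma Int_stable_cylinders: "Int_stable cylinders"
proof -
  have "cyl k v \<inter> cyl l u \<in> cylinders" if "k \<le> l" for k l and v u :: "nat \<Rightarrow> bool"
  proof (cases "u \<in> cyl k v")
    case True
    then have "cyl k v \<inter> cyl l u = cyl l u" using that by (auto simp: cyl_def)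
    then show ?thesis by (simp add: cyl_in_cylinders)
  next
    case False
    then have "cyl k v \<inter> cyl l u = {}" using that by (auto simp: cyl_def)
    then show ?thesis by (simp add: cylinders_def)
  qed
  moreover have "k \<le> l \<or> l \<le> k" for k l :: nat by auto
  ultimately have "cyl k v \<inter> cyl l u \<in> cylinders" for k l and v u :: "nat \<Rightarrow> bool"
    by (metis Int_commute)
  then show ?thesis
    by (auto simp: Int_stable_def cylinders_def)
qed

lemma bindigits_measurable: "bindigits \<in> measurable borel borel"
  unfolding borel_eq_cylinders
proof (rule measurable_measure_of)
  fix C assume "C \<in> cylinders"
  moreover have "bindigits -` cyl k v \<in> sets borel" for k v
  proof -
    have [measurable]: "(\<lambda>x::real. \<lfloor>2 ^ Suc n * x\<rfloor>) \<in> measurable borel (count_space UNIV)" for n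
      using measurable_compose[OF _ measurable_real_floor] by measurable
    have "bindigits -` cyl k v = {x \<in> space borel. \<forall>n<k. odd \<lfloor>2 ^ Suc n * x\<rfloor> = v n}"
      by (auto simp: cyl_def bindigits_def)
    also have "\<dots> \<in> sets borel" by measurable
    finally show ?thesis .
  qed
  ultimately show "bindigits -` C \<inter> space borel \<in> sets borel"
    by (auto simp: cylinders_def)
qed auto

section \<open>The coin-tossing measure as the law of the binary digits of a uniform point\<close>

definition coin :: "(nat \<Rightarrow> bool) measure" where
  "coin = distr (restrict_space lborel {0..<1}) borel bindigits"

lemma sets_coin [simp, measurable_cong]: "sets coin = sets borel"
  and space_coin [simp]: "space coin = UNIV"
  by (auto simp: coin_def)

lemma emeasure_coin:
  assumes "A \<in> sets borel"
  shows "emeasure coin A = emeasure lborel (bindigits -` A \<inter> {0..<1})"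
proof -
  have "bindigits \<in> measurable (restrict_space lborel {0..<1}) borel"
    by (intro measurable_restrict_space1) (simp add: bindigits_measurable)
  then show ?thesis
    unfolding coin_def using assms
    by (simp add: emeasure_distr emeasure_restrict_space space_restrict_space)
qed

lemma emeasure_coin_cyl: "emeasure coin (cyl k v) = ennreal ((1/2) ^ k)"
proof -
  have "bindigits -` cyl k v \<inter> {0..<1} = {x. \<lfloor>2 ^ k * x\<rfloor> = binnum k v}"
    by (intro set_eqI) (auto simp: bindigits_cyl_iff[symmetric])
  also have "\<dots> = {binnum k v / 2 ^ k ..< binnum k v / 2 ^ k + (1/2) ^ k}"
    by (auto simp: floor_eq_iff field_simps power_one_over)
  finally show ?thesis
    using emeasure_coin[OF borel_open[OF open_cyl[of k v]]] by simp
qed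

lemma emeasure_coin_UNIV: "emeasure coin UNIV = 1"
  using emeasure_coin_cyl[of 0] by (simp add: cyl_def)

interpretation coin: finite_measure coin
  by standard (simp add: emeasure_coin_UNIV)

lemma measure_coin_UNIV: "measure coin UNIV = 1"
  by (simp add: measure_def emeasure_coin_UNIV)

lemma coin_eqI:
  assumes "sets M = sets borel" "\<And>k v. emeasure M (cyl k v) = ennreal ((1/2) ^ k)"
  shows "M = coin"
proof (rule measure_eqI_generator_eq[OF Int_stable_cylinders, where \<Omega> = UNIV and A = "\<lambda>_. UNIV"])
  have *: "UNIV = cyl 0 (undefined :: nat \<Rightarrow> bool)" by (auto simp: cyl_def)
  then have "UNIV \<in> cylinders" using cyl_in_cylinders by metis
  then show "range (\<lambda>_::nat. UNIV) \<subseteq> cylinders" by auto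
  show "emeasure M UNIV \<noteq> \<infinity>" by (subst *) (simp add: assms(2))
  show "sets M = sigma_sets UNIV cylinders" "sets coin = sigma_sets UNIV cylinders"
    using assms(1) by (simp_all add: borel_eq_cylinders)
  show "emeasure M X = emeasure coin X" if "X \<in> cylinders" for X
    using that by (auto simp: cylinders_def assms(2) emeasure_coin_cyl)
qed auto

section \<open>Bit flips and the independence of distinct coordinates\<close>

definition flip :: "nat \<Rightarrow> (nat \<Rightarrow> bool) \<Rightarrow> nat \<Rightarrow> bool" where
  "flip n w = w(n := \<not> w n)"

lemma flip_same [simp]: "flip n w n = (\<not> w n)"
  and flip_other [simp]: "m \<noteq> n \<Longrightarrow> flip n w m = w m"
  by (auto simp: flip_def)

lemma flip_measurable [measurable]: "flip n \<in> measurable borel borel"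
proof -
  have "continuous_on UNIV (\<lambda>w. flip n w i)" for i
  proof (rule continuous_on_cylI)
    fix U :: "bool set" and x assume "flip n x i \<in> U"
    then show "\<exists>k. \<forall>w\<in>cyl k x. flip n w i \<in> U"
      by (intro exI[of _ "Suc (max n i)"]) (auto simp: flip_def cyl_def less_Suc_eq_le)
  qed
  then have "continuous_on UNIV (flip n)"
    by (intro continuous_on_coordinatewise_then_product)
  then show ?thesis by (rule borel_measurable_continuous_onI)
qed

lemma distr_flip: "distr coin borel (flip n) = coin"
proof (rule coin_eqI)
  fix k and v :: "nat \<Rightarrow> bool"
  have "flip n -` cyl k v = cyl k (if n < k then flip n v else v)"
    by (auto simp: cyl_def flip_def split: if_splits)
  then show "emeasure (distr coin borel (flip n)) (cyl k v) = ennreal ((1/2) ^ k)"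
    using open_cyl[of k v] by (subst emeasure_distr) (auto simp: emeasure_coin_cyl)
qed simp

lemma measure_flip:
  assumes "A \<in> sets borel"
  shows "measure coin (flip n -` A) = measure coin A"
proof -
  have "measure coin A = measure (distr coin borel (flip n)) A" by (simp add: distr_flip)
  also have "\<dots> = measure coin (flip n -` A)"
    using assms by (subst measure_distr) auto
  finally show ?thesis by simp
qed

lemma borel_coordinate [measurable]: "{w. w n = b} \<in> sets (borel :: (nat \<Rightarrow> bool) measure)"
proof -
  have "open ((\<lambda>w :: nat \<Rightarrow> bool. w n) -` {b})"
    by (intro open_vimage) (auto simp: open_discrete)
  then show ?thesis by (simp add: vimage_def)
qed

lemma borel_coordinates:
  "finite Q \<Longrightarrow> {z. \<forall>n\<in>Q. z (c n) = u n} \<in> sets (borel :: (nat \<Rightarrow> bool) measure)"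
proof (induction Q rule: finite_induct)
  case (insert n Q)
  have "{z. \<forall>m\<in>insert n Q. z (c m) = u m} = {z. z (c n) = u n} \<inter> {z. \<forall>m\<in>Q. z (c m) = u m}"
    by auto
  with insert.IH borel_coordinate show ?case by auto
qed simp

text \<open>Flipping bit \<open>c n\<close> preserves the measure, leaves the earlier conditions
  alone because \<open>c\<close> is injective, and exchanges the two values of the new bit. Each new
  condition therefore halves the measure.\<close>

lemma measure_coordinates:
  assumes "finite Q" "inj_on c Q"
  shows "measure coin {z. \<forall>n\<in>Q. z (c n) = u n} = (1/2) ^ card Q"
  using assms
proof (induction Q rule: finite_induct)
  case empty
  show ?case by (simp add: measure_coin_UNIV)
next
  case (insert n Q)
  define A where "A = {z. \<forall>m\<in>Q. z (c m) = u m}"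
  define B where "B b = A \<inter> {z. z (c n) = b}" for b
  have [measurable]: "A \<in> sets borel" unfolding A_def using insert by (intro borel_coordinates)
  have Bm: "B b \<in> sets borel" for b unfolding B_def by auto
  have "flip (c n) -` B b = B (\<not> b)" for b
  proof -
    have "c m \<noteq> c n" if "m \<in> Q" for m
      using inj_onD[OF insert.prems, of m n] insert.hyps(2) that by auto
    then show ?thesis unfolding B_def A_def by auto
  qed
  then have "measure coin (B (\<not> b)) = measure coin (B b)" for b
    using measure_flip[OF Bm] by metis
  moreover have "measure coin A = measure coin (B (u n)) + measure coin (B (\<not> u n))"
  proof -
    have "A = B (u n) \<union> B (\<not> u n)" unfolding B_def by auto
    then show ?thesis
      using coin.finite_measure_Union[of "B (u n)" "B (\<not> u n)"] Bm by (auto simp: B_def)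
  qed
  ultimately have "measure coin (B (u n)) = measure coin A / 2" by simp
  moreover have "measure coin A = (1/2) ^ card Q" unfolding A_def using insert by auto
  moreover have "{z. \<forall>m\<in>insert n Q. z (c m) = u m} = B (u n)" unfolding A_def B_def by auto
  ultimately show ?case using insert by simp
qed

section \<open>Transfer of Lebesgue measurability to binary sequences\<close>

lemma binval_measurable [measurable]: "binval \<in> measurable borel borel"
  by (rule borel_measurable_continuous_onI[OF continuous_binval])

text \<open>\<open>coin\<close> measures sets through \<open>bindigits\<close> on
  \<open>[0, 1)\<close>, where \<open>binval\<close> undoes it; so only points of \<open>N\<close>
  are counted.\<close>

lemma null_binval_vimage:
  assumes "N \<in> null_sets lborel"
  shows "binval -` N \<in> null_sets coin"
proof
  have N: "N \<in> sets borel" "emeasure lborel N = 0" using assms by auto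
  then show "binval -` N \<in> sets coin"
    using measurable_sets_borel[OF binval_measurable] by simp
  have "bindigits -` binval -` N \<inter> {0..<1} \<subseteq> N"
    using binval_bindigits by auto
  then have "emeasure lborel (bindigits -` binval -` N \<inter> {0..<1}) = 0"
    using N emeasure_mono[of _ N lborel] by (metis le_zero_eq sets_lborel)
  then show "emeasure coin (binval -` N) = 0"
    using measurable_sets_borel[OF binval_measurable] N by (simp add: emeasure_coin)
qed

text \<open>Off the rationals \<open>binval\<close> is injective, so there \<open>E\<close> is the
  full preimage of its image. The preimage of the rationals is null because they are
  countable.\<close>

lemma completion_coin_transfer:
  assumes "binval ` E - \<rat> \<in> sets lebesgue"
  shows "E \<in> sets (completion coin)"
proof -
  obtain S N N' where SN: "binval ` E - \<rat> = S \<union> N" "N \<subseteq> N'" "N' \<in> null_sets lborel" "S \<in> sets lborel"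
    using assms by (rule sets_completionE)
  have Q: "binval -` \<rat> \<in> null_sets coin"
    by (intro null_binval_vimage countable_imp_null_set_lborel countable_rat)
  define R where "R = E \<inter> binval -` \<rat>"
  have "E = binval -` S \<union> (binval -` N \<union> R)"
  proof -
    have "y \<in> E" if y: "binval y \<in> binval ` E - \<rat>" for y
      using y binval_eq_cases by auto metis
    then show ?thesis using SN(1) unfolding R_def by blast
  qed
  moreover have "binval -` N \<union> R \<subseteq> binval -` N' \<union> binval -` \<rat>"
    using SN(2) by (auto simp: R_def)
  moreover have "binval -` N' \<union> binval -` \<rat> \<in> null_sets coin"
    using null_binval_vimage[OF SN(3)] Q by auto
  moreover have "binval -` S \<in> sets coin"
    using SN(4) measurable_sets_borel[OF binval_measurable] by simp
  ultimately show ?thesis by (rule sets_completionI)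
qed

section \<open>Null sets\<close>

text \<open>The single-bit flips of a graph at the coordinates of the dependent variable are disjoint
  sets of equal measure.\<close>

lemma null_if_determined_off_infinite:
  assumes G: "G \<in> sets (completion coin)" and S: "infinite S"
    and det: "\<And>w w'. w \<in> G \<Longrightarrow> w' \<in> G \<Longrightarrow> (\<And>n. n \<notin> S \<Longrightarrow> w n = w' n) \<Longrightarrow> w = w'"
  shows "G \<in> null_sets (completion coin)"
proof -
  \<comment> \<open>The flips act on the Borel part \<open>B\<close>, to which
    \<open>measure_flip\<close> applies; the rest of \<open>G\<close> lies in a null set.\<close>
  obtain B N N' where BN: "G = B \<union> N" "N \<subseteq> N'" "N' \<in> null_sets coin" "B \<in> sets coin"
    using G by (rule sets_completionE)
  have B: "B \<in> sets borel" using BN(4) by simp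
  have flipB: "flip n -` B \<in> sets coin" for n
    using measurable_sets_borel[OF flip_measurable B] by simp
  have disj: "disjoint_family_on (\<lambda>n. flip n -` B) S"
    unfolding disjoint_family_on_def
  proof (intro ballI impI)
    fix m n assume mn: "m \<in> S" "n \<in> S" "m \<noteq> n"
    \<comment> \<open>The two flips of \<open>w\<close> agree outside \<open>S\<close>, so
      \<open>det\<close> would identify them.\<close>
    have False if "flip m w \<in> B" "flip n w \<in> B" for w
    proof -
      have "flip m w = flip n w"
        by (rule det) (use that mn BN(1) in \<open>auto simp: flip_def\<close>)
      then have "flip m w m = flip n w m" by simp
      with mn show False by simp
    qed
    then show "flip m -` B \<inter> flip n -` B = {}" by auto
  qed
  have "measure coin B = 0"
  proof (rule ccontr)
    assume "measure coin B \<noteq> 0"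
    then have pos: "measure coin B > 0" by (simp add: zero_less_measure_iff)
    obtain k :: nat where k: "1 / measure coin B < k" using reals_Archimedean2 by blast
    obtain T where T: "T \<subseteq> S" "finite T" "card T = k"
      using infinite_arbitrarily_large[OF S] by blast
    have "k * measure coin B = (\<Sum>n\<in>T. measure coin (flip n -` B))"
      using T by (simp add: measure_flip[OF B])
    also have "\<dots> = measure coin (\<Union>n\<in>T. flip n -` B)"
      by (rule coin.finite_measure_finite_Union[symmetric])
        (use T flipB disjoint_family_on_mono[OF T(1) disj] in auto)
    also have "\<dots> \<le> 1"
      using coin.bounded_measure by (simp add: measure_coin_UNIV)
    finally show False using k pos by (simp add: field_simps)
  qed
  then have "B \<in> null_sets coin"
    using BN(4) coin.emeasure_eq_measure by auto
  then have "B \<union> N' \<in> null_sets coin" using BN(3) by auto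
  moreover have "G \<subseteq> B \<union> N'" using BN by auto
  ultimately show ?thesis by (rule null_sets_completion_subset[OF _ null_sets_completionI, rotated])
qed

text \<open>Binary sequences embed by \<open>f\<close> into real sequences, where outer regularity
  applies to the image measure. The Borel left inverse \<open>r\<close> of \<open>f\<close> turns
  \<open>N\<close> into a Borel set of real sequences that \<open>f\<close> pulls back to
  \<open>N\<close>.\<close>

lemma coin_outer_open:
  assumes N: "N \<in> null_sets coin" and "e > 0"
  obtains U where "open U" "N \<subseteq> U" "measure coin U < e"
proof -
  define f :: "(nat \<Rightarrow> bool) \<Rightarrow> nat \<Rightarrow> real" where "f w = (\<lambda>n. of_bool (w n))" for w
  define r :: "(nat \<Rightarrow> real) \<Rightarrow> nat \<Rightarrow> bool" where "r x = (\<lambda>n. x n > 0)" for x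
  have rf: "r (f w) = w" for w by (auto simp: f_def r_def)
  have contf: "continuous_on UNIV f"
    unfolding f_def
  proof (intro continuous_on_coordinatewise_then_product continuous_on_cylI)
    fix n and x :: "nat \<Rightarrow> bool" and U :: "real set" assume "of_bool (x n) \<in> U"
    then show "\<exists>k. \<forall>w\<in>cyl k x. of_bool (w n) \<in> U"
      by (intro exI[of _ "Suc n"]) (auto simp: cyl_def)
  qed
  have [measurable]: "f \<in> measurable coin borel"
    using borel_measurable_continuous_onI[OF contf] by simp
  have rm: "r \<in> measurable borel borel"
    unfolding borel_eq_cylinders
  proof (rule measurable_measure_of)
    fix C assume "C \<in> cylinders"
    moreover have "r -` cyl k v \<in> sets borel" for k v
    proof -
      have [measurable]: "(\<lambda>x :: nat \<Rightarrow> real. x n) \<in> borel_measurable borel" for n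
        by (rule borel_measurable_continuous_onI) simp
      have "r -` cyl k v = {x \<in> space borel. \<forall>n<k. (x n > 0) = v n}"
        by (auto simp: cyl_def r_def)
      also have "\<dots> \<in> sets borel" by measurable
      finally show ?thesis .
    qed
    ultimately show "r -` C \<inter> space borel \<in> sets borel"
      by (auto simp: cylinders_def)
  qed auto
  define M where "M = distr coin borel f"
  have Nb: "N \<in> sets borel" "emeasure coin N = 0" using N by auto
  have rN: "r -` N \<in> sets borel" using measurable_sets_borel[OF rm Nb(1)] .
  have "f -` r -` N = N" by (auto simp: rf)
  then have "emeasure M (r -` N) = 0"
    unfolding M_def using rN Nb by (subst emeasure_distr) auto
  moreover have "emeasure M (r -` N) = (INF U \<in> {U. r -` N \<subseteq> U \<and> open U}. emeasure M U)"
  proof (rule outer_regular[OF _ _ rN])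
    show "sets M = sets borel" by (simp add: M_def)
    show "emeasure M (space M) \<noteq> \<infinity>"
      unfolding M_def by (subst emeasure_distr) (auto simp: emeasure_coin_UNIV)
  qed
  ultimately have "(INF U \<in> {U. r -` N \<subseteq> U \<and> open U}. emeasure M U) < ennreal e"
    using \<open>e > 0\<close> by simp
  then obtain U where U: "r -` N \<subseteq> U" "open U" "emeasure M U < ennreal e"
    unfolding INF_less_iff by auto
  have "open (f -` U)" using contf U(2) by (simp add: continuous_on_open_vimage)
  moreover have "N \<subseteq> f -` U" using U(1) rf by auto
  moreover have "emeasure M U = emeasure coin (f -` U)"
    unfolding M_def using U(2) by (subst emeasure_distr) auto
  then have "measure coin (f -` U) < e"
    using U(3) \<open>e > 0\<close> by (simp add: coin.emeasure_eq_measure ennreal_less_iff)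
  ultimately show ?thesis by (rule that)
qed

section \<open>Covers by cylinders of finite words\<close>

definition list_cyl :: "bool list \<Rightarrow> (nat \<Rightarrow> bool) set" where
  "list_cyl u = cyl (length u) (\<lambda>n. u ! n)"

lemma open_list_cyl: "open (list_cyl u)"
  by (simp add: list_cyl_def open_cyl)

lemma measure_list_cyl: "measure coin (list_cyl u) = (1/2) ^ length u"
  by (simp add: list_cyl_def measure_def emeasure_coin_cyl)

lemma list_cyl_map: "list_cyl (map w [0..<k]) = cyl k w"
  by (auto simp: list_cyl_def cyl_def)

lemma in_list_cyl_iff: "w \<in> list_cyl u \<longleftrightarrow> u = map w [0..<length u]"
proof
  assume "w \<in> list_cyl u"
  then show "u = map w [0..<length u]"
    by (intro nth_equalityI) (auto simp: list_cyl_def cyl_def)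
next
  assume "u = map w [0..<length u]"
  then have "list_cyl u = cyl (length u) w" using list_cyl_map by metis
  then show "w \<in> list_cyl u" by (simp add: cyl_def)
qed

text \<open>Take the shortest words whose cylinders fit into \<open>U\<close>. None is a proper
  prefix of another, so their cylinders are disjoint and the measures add up.\<close>

lemma open_as_cylinders:
  fixes U :: "(nat \<Rightarrow> bool) set"
  assumes "open U"
  obtains T where "U = (\<Union>u\<in>T. list_cyl u)"
    and "\<And>F. finite F \<Longrightarrow> F \<subseteq> T \<Longrightarrow> (\<Sum>u\<in>F. (1/2) ^ length u) \<le> measure coin U"
proof
  define T where "T = {u. list_cyl u \<subseteq> U \<and> (\<forall>k<length u. \<not> list_cyl (take k u) \<subseteq> U)}"
  show U: "U = (\<Union>u\<in>T. list_cyl u)"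
  proof (intro equalityI subsetI)
    fix w assume "w \<in> U"
    then have ex: "\<exists>k. cyl k w \<subseteq> U" using open_contains_cyl[OF assms] by blast
    define k where "k = (LEAST k. cyl k w \<subseteq> U)"
    have "cyl k w \<subseteq> U" unfolding k_def using ex by (rule LeastI_ex)
    moreover have "\<not> cyl i w \<subseteq> U" if "i < k" for i
      using that not_less_Least unfolding k_def by blast
    ultimately have "map w [0..<k] \<in> T"
      by (auto simp: T_def list_cyl_map take_map)
    moreover have "w \<in> list_cyl (map w [0..<k])" by (simp add: in_list_cyl_iff)
    ultimately show "w \<in> (\<Union>u\<in>T. list_cyl u)" by blast
  qed (auto simp: T_def)
  have prefix_free: "u = v"
    if "u \<in> T" "v \<in> T" "w \<in> list_cyl u" "w \<in> list_cyl v" "length u \<le> length v" for u v w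
  proof -
    have uv: "u = map w [0..<length u]" "v = map w [0..<length v]"
      using that by (simp_all add: in_list_cyl_iff)
    have "take (length u) v = map w (take (length u) [0..<length v])"
      by (subst uv(2)) (simp add: take_map)
    also have "\<dots> = u" using uv(1) that(5) by simp
    finally have "take (length u) v = u" .
    moreover have "\<not> length u < length v"
      using that(1,2) \<open>take (length u) v = u\<close> unfolding T_def by force
    ultimately show ?thesis using that(5) by simp
  qed
  have disj: "disjoint_family_on list_cyl T"
    unfolding disjoint_family_on_def using prefix_free by (metis disjoint_iff nat_le_linear)
  fix F assume F: "finite F" "F \<subseteq> T"
  have "(\<Sum>u\<in>F. (1/2) ^ length u) = (\<Sum>u\<in>F. measure coin (list_cyl u))"
    by (simp add: measure_list_cyl)
  also have "\<dots> = measure coin (\<Union>u\<in>F. list_cyl u)"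
    by (rule coin.finite_measure_finite_Union[symmetric])
      (use F disjoint_family_on_mono[OF F(2) disj] in \<open>auto simp: open_list_cyl\<close>)
  also have "\<dots> \<le> measure coin U"
    by (rule coin.finite_measure_mono) (use F assms in \<open>auto simp: U\<close>)
  finally show "(\<Sum>u\<in>F. (1/2) ^ length u) \<le> measure coin U" .
qed

text \<open>Cover \<open>N\<close> by open sets \<open>U i\<close> of measure below
  \<open>(1/2) ^ Suc i\<close> and list the cylinders of all of them in one sequence. The weights
  sum to at most 1, and a point of \<open>N\<close> lies in a cylinder from every
  \<open>U i\<close>.\<close>

lemma null_set_limsup_cylinders:
  assumes N: "N \<in> null_sets (completion coin)"
  obtains u :: "nat \<Rightarrow> bool list" and A :: "nat set"
  where "summable (\<lambda>j. of_bool (j \<in> A) * (1/2 :: real) ^ length (u j))"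
    and "\<And>w J. w \<in> N \<Longrightarrow> \<exists>j\<ge>J. j \<in> A \<and> w \<in> list_cyl (u j)"
proof -
  obtain N' where N': "N' \<in> null_sets coin" "N \<subseteq> N'"
    using N by (auto simp: null_sets_completion_iff2)
  have "\<exists>U. open U \<and> N' \<subseteq> U \<and> measure coin U < (1/2) ^ Suc i" for i
  proof -
    have "(1/2 :: real) ^ Suc i > 0" by simp
    from coin_outer_open[OF N'(1) this] show ?thesis by metis
  qed
  then obtain U where U: "\<And>i. open (U i)" "\<And>i. N' \<subseteq> U i" "\<And>i. measure coin (U i) < (1/2) ^ Suc i"
    by metis
  have "\<exists>T. U i = (\<Union>u\<in>T. list_cyl u) \<and>
          (\<forall>F. finite F \<longrightarrow> F \<subseteq> T \<longrightarrow> (\<Sum>u\<in>F. (1/2) ^ length u) \<le> measure coin (U i))" for i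
    using open_as_cylinders[OF U(1), of i] by metis
  then obtain T where T: "\<And>i. U i = (\<Union>u\<in>T i. list_cyl u)"
    "\<And>i F. finite F \<Longrightarrow> F \<subseteq> T i \<Longrightarrow> (\<Sum>u\<in>F. (1/2) ^ length u) \<le> measure coin (U i)"
    by metis
  define u :: "nat \<Rightarrow> bool list" where "u j = from_nat (snd (prod_decode j))" for j
  \<comment> \<open>An index \<open>j\<close> codes a pair of \<open>i\<close> and the number of a
    word; \<open>A\<close> keeps the pairs whose word belongs to \<open>T i\<close>.\<close>
  define A where "A = {j. snd (prod_decode j) \<in> to_nat ` T (fst (prod_decode j))}"
  define g where "g = (\<lambda>(i, q). of_bool (q \<in> to_nat ` T i) * (1/2 :: real) ^ length (from_nat q :: bool list))"
  have row: "(\<Sum>q\<le>n. g (i, q)) \<le> (1/2) ^ Suc i" for i n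
  proof -
    define F where "F = {u \<in> T i. to_nat u \<le> n}"
    have F: "finite F" "F \<subseteq> T i"
      unfolding F_def by (auto intro: finite_subset[OF _ finite_vimageI[of "{..n}" "to_nat :: bool list \<Rightarrow> nat"]])
    have "(\<Sum>q\<le>n. g (i, q)) = (\<Sum>q\<in>to_nat ` F. g (i, q))"
      by (rule sum.mono_neutral_right) (auto simp: g_def F_def)
    also have "\<dots> = (\<Sum>u\<in>F. g (i, to_nat u))"
      by (rule sum.reindex_cong[of to_nat]) auto
    also have "\<dots> = (\<Sum>u\<in>F. (1/2) ^ length u)"
      by (rule sum.cong) (auto simp: g_def F_def)
    also have "\<dots> \<le> measure coin (U i)" using T(2) F by blast
    also have "\<dots> \<le> (1/2) ^ Suc i" using U(3) less_imp_le by blast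
    finally show ?thesis .
  qed
  have "summable (\<lambda>j. g (prod_decode j))"
  proof (rule bounded_imp_summable)
    show "g (prod_decode j) \<ge> 0" for j by (auto simp: g_def split: prod.split)
    fix n
    have "(\<Sum>j\<le>n. g (prod_decode j)) = sum g (prod_decode ` {..n})"
      by (rule sum.reindex_cong[symmetric, of prod_decode]) (auto simp: inj_prod_decode inj_on_subset)
    also have "\<dots> \<le> sum g ({..n} \<times> {..n})"
    proof (rule sum_mono2)
      have le: "fst (prod_decode j) \<le> j" "snd (prod_decode j) \<le> j" for j
        using le_prod_encode_1[of "fst (prod_decode j)" "snd (prod_decode j)"]
          le_prod_encode_2[of "snd (prod_decode j)" "fst (prod_decode j)"] by simp_all
      show "prod_decode ` {..n} \<subseteq> {..n} \<times> {..n}"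
      proof (rule image_subsetI)
        fix j assume "j \<in> {..n}"
        with le[of j] show "prod_decode j \<in> {..n} \<times> {..n}"
          by (simp add: mem_Times_iff)
      qed
    qed (auto simp: g_def)
    also have "\<dots> = (\<Sum>i\<le>n. \<Sum>q\<le>n. g (i, q))"
      by (simp add: sum.cartesian_product)
    also have "\<dots> \<le> (\<Sum>i\<le>n. (1/2) ^ Suc i)" by (intro sum_mono row)
    also have "\<dots> \<le> (\<Sum>i. (1/2) ^ Suc i)"
      by (rule sum_le_suminf) (auto simp: summable_geometric)
    also have "\<dots> = 1" using sums_unique[OF power_half_series] by simp
    finally show "(\<Sum>j\<le>n. g (prod_decode j)) \<le> 1" .
  qed
  moreover have "g (prod_decode j) = of_bool (j \<in> A) * (1/2) ^ length (u j)" for j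
    by (auto simp: g_def A_def u_def split: prod.split)
  ultimately have 1: "summable (\<lambda>j. of_bool (j \<in> A) * (1/2 :: real) ^ length (u j))" by simp
  have 2: "\<exists>j\<ge>J. j \<in> A \<and> w \<in> list_cyl (u j)" if "w \<in> N" for w J
  proof -
    have "w \<in> U J" using that N'(2) U(2) by blast
    then obtain v where v: "v \<in> T J" "w \<in> list_cyl v" using T(1) by blast
    then show ?thesis
      \<comment> \<open>The code of a pair is at least its first entry, which gives
        \<open>J \<le> j\<close>.\<close>
      by (intro exI[of _ "prod_encode (J, to_nat v)"]) (auto simp: A_def u_def le_prod_encode_1)
  qed
  from that[OF 1 2] show ?thesis .
qed

section \<open>Mycielski's theorem for null sets\<close>

text \<open>One sequence \<open>z\<close> supplies all random bits: \<open>to_nat\<close> gives each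
  pair of a node and a position its own index.\<close>

definition random_branch :: "(nat \<Rightarrow> nat) \<Rightarrow> (nat \<Rightarrow> bool) \<Rightarrow> (nat \<Rightarrow> bool) \<Rightarrow> nat \<Rightarrow> bool" where
  "random_branch \<kappa> z t p = z (to_nat (map t [0..<\<kappa> p], p))"

lemma continuous_random_branch: "continuous_on UNIV (random_branch \<kappa> z)"
proof (rule continuous_on_coordinatewise_then_product, rule continuous_on_cylI)
  fix p t and U :: "bool set" assume *: "random_branch \<kappa> z t p \<in> U"
  have "random_branch \<kappa> z w p \<in> U" if "w \<in> cyl (\<kappa> p) t" for w
  proof -
    have "map w [0..<\<kappa> p] = map t [0..<\<kappa> p]" using that by (auto simp: cyl_def)
    then have "random_branch \<kappa> z w p = random_branch \<kappa> z t p"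
      unfolding random_branch_def by (rule arg_cong)
    with * show ?thesis by simp
  qed
  then show "\<exists>k. \<forall>w\<in>cyl k t. random_branch \<kappa> z w p \<in> U" by blast
qed

text \<open>Position \<open>n\<close> of the interleaved tuple is position \<open>pos n\<close> of its component \<open>col n\<close>. Once the
  nodes \<open>s i\<close> have split, all positions from \<open>l\<close> on read distinct random bits.\<close>

lemma measure_random_branch_cylinder:
  fixes col :: "nat \<Rightarrow> 'j::finite" and pos :: "nat \<Rightarrow> nat" and s :: "'j \<Rightarrow> bool list"
    and u :: "bool list"
  assumes inj: "inj (\<lambda>n. (col n, pos n))" and split: "inj (\<lambda>i. take k (s i))"
    and \<kappa>: "\<And>p. l \<le> p \<Longrightarrow> k \<le> \<kappa> p"
  defines "D \<equiv> {z. \<forall>n<length u. z (to_nat (take (\<kappa> (pos n)) (s (col n)), pos n)) = u ! n}"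
  shows "D \<in> sets borel"
    and "measure coin D \<le> 2 ^ (CARD('j) * l) * (1/2) ^ length u"
proof -
  define c where "c n = to_nat (take (\<kappa> (pos n)) (s (col n)), pos n)" for n
  define Q where "Q = {n\<in>{..<length u}. l \<le> pos n}"
  define R where "R = {n\<in>{..<length u}. pos n < l}"
  have D: "D = {z. \<forall>n\<in>{..<length u}. z (c n) = u ! n}"
    unfolding D_def c_def by auto
  show "D \<in> sets borel"
    unfolding D by (rule borel_coordinates) simp
  have "inj_on c Q"
  proof (rule inj_onI)
    fix m n assume mn: "m \<in> Q" "n \<in> Q" "c m = c n"
    then have p: "pos m = pos n"
      and t: "take (\<kappa> (pos n)) (s (col m)) = take (\<kappa> (pos n)) (s (col n))"
      unfolding c_def by auto
    \<comment> \<open>At late positions at least \<open>k\<close> entries of a node are read, and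
      these already distinguish the nodes, so equal indices force equal columns.\<close>
    have "k \<le> \<kappa> (pos n)" using mn \<kappa> unfolding Q_def by auto
    then have "take k (s (col m)) = take k (s (col n))"
      using arg_cong[OF t, of "take k"] by (simp add: min_absorb1)
    then have "col m = col n" using split by (auto dest: injD)
    with p show "m = n" using inj by (auto dest: injD)
  qed
  moreover have "finite Q" unfolding Q_def by auto
  ultimately have "measure coin {z. \<forall>n\<in>Q. z (c n) = u ! n} = (1/2) ^ card Q"
    by (intro measure_coordinates)
  moreover have "measure coin D \<le> measure coin {z. \<forall>n\<in>Q. z (c n) = u ! n}"
    by (rule coin.finite_measure_mono)
      (use \<open>finite Q\<close> borel_coordinates in \<open>auto simp: D Q_def\<close>)
  \<comment> \<open>Each column has at most \<open>l\<close> early positions; only for these may the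
    random bits coincide.\<close>
  moreover have "length u \<le> CARD('j) * l + card Q"
  proof -
    have "card R \<le> card ((UNIV :: 'j set) \<times> {..<l})"
      by (rule card_inj_on_le[of "\<lambda>n. (col n, pos n)"])
        (use inj in \<open>auto simp: R_def intro: inj_on_subset\<close>)
    moreover have "card (R \<union> Q) \<le> card R + card Q" by (rule card_Un_le)
    moreover have "R \<union> Q = {..<length u}" by (auto simp: R_def Q_def)
    ultimately show ?thesis by (simp add: card_cartesian_product)
  qed
  then have "(1/2 :: real) ^ (CARD('j) * l + card Q) \<le> (1/2) ^ length u"
    by (intro power_decreasing) auto
  then have "(1/2 :: real) ^ card Q \<le> 2 ^ (CARD('j) * l) * (1/2) ^ length u"
    by (simp add: power_add field_simps power_one_over)
  ultimately show "measure coin D \<le> 2 ^ (CARD('j) * l) * (1/2) ^ length u" by linarith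
qed

lemma card_split_nodes:
  fixes k m :: nat
  defines "S \<equiv> {s :: 'j::finite \<Rightarrow> bool list. (\<forall>i. length (s i) = k) \<and> inj (\<lambda>i. take m (s i))}"
  shows "finite S" and "card S \<le> 2 ^ (k * CARD('j))"
proof -
  define L where "L = {xs :: bool list. length xs = k}"
  have L: "finite L" "card L = 2 ^ k"
    unfolding L_def using finite_lists_length_eq[of "UNIV :: bool set" k]
      card_lists_length_eq[of "UNIV :: bool set" k] by (simp_all add: card_UNIV_bool)
  have sub: "S \<subseteq> (UNIV :: 'j set) \<rightarrow>\<^sub>E L" by (auto simp: S_def L_def)
  have fin: "finite ((UNIV :: 'j set) \<rightarrow>\<^sub>E L)" using L by (intro finite_PiE) auto
  from sub fin show "finite S" by (rule finite_subset)
  have "card S \<le> card ((UNIV :: 'j set) \<rightarrow>\<^sub>E L)" using fin sub by (rule card_mono)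
  also have "\<dots> = 2 ^ (k * CARD('j))" using L by (simp add: card_funcsetE power_mult)
  finally show "card S \<le> 2 ^ (k * CARD('j))" .
qed

lemma eventually_split:
  fixes t :: "'j::finite \<Rightarrow> nat \<Rightarrow> 'a"
  assumes "inj t"
  obtains k0 where "\<And>k. k0 \<le> k \<Longrightarrow> inj (\<lambda>i. map (t i) [0..<k])"
proof -
  have "\<exists>n. i \<noteq> i' \<longrightarrow> t i n \<noteq> t i' n" for i i'
    using assms by (metis ext injD)
  then obtain d where d: "\<And>i i'. i \<noteq> i' \<Longrightarrow> t i (d i i') \<noteq> t i' (d i i')"
    by metis
  define k0 where "k0 = Suc (\<Sum>(i, i')\<in>UNIV. d i i')"
  have dk: "d i i' < k0" for i i'
    using member_le_sum[of "(i, i')" UNIV "\<lambda>(i, i'). d i i'"] by (simp add: k0_def)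
  show ?thesis
  proof (rule that, rule injI, rule ccontr)
    fix k i i' assume k: "k0 \<le> k" and eq: "map (t i) [0..<k] = map (t i') [0..<k]" and ne: "i \<noteq> i'"
    have "d i i' < k" using dk[of i i'] k by simp
    then have "t i (d i i') = t i' (d i i')" using eq by (auto simp: map_eq_conv)
    with d[OF ne] show False by simp
  qed
qed

text \<open>Stage \<open>k\<close> treats the cylinders with index from \<open>J k\<close> up to
  \<open>J (Suc k)\<close> and the tuples of branches separated by their first \<open>k\<close>
  entries. There are at most \<open>2 ^ (Suc k * c)\<close> node tuples, each of which hits
  \<open>list_cyl (u j)\<close> with probability at most
  \<open>2 ^ (c * lv k) * (1/2) ^ length (u j)\<close>. The choice of \<open>J k\<close> makes the
  remaining weights outweigh both factors, and the failure probabilities sum to at most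
  \<open>1/2\<close>.\<close>

lemma mycielski_null:
  fixes col :: "nat \<Rightarrow> 'j::finite" and pos :: "nat \<Rightarrow> nat"
  assumes inj: "inj (\<lambda>n. (col n, pos n))" and N: "N \<in> null_sets (completion coin)"
  shows "\<exists>\<psi> :: (nat \<Rightarrow> bool) \<Rightarrow> nat \<Rightarrow> bool. continuous_on UNIV \<psi> \<and>
    (\<forall>t. inj t \<longrightarrow> (\<lambda>n. \<psi> (t (col n)) (pos n)) \<notin> N)"
proof -
  obtain u A where sm: "summable (\<lambda>j. of_bool (j \<in> A) * (1/2 :: real) ^ length (u j))"
    and io: "\<And>w J. w \<in> N \<Longrightarrow> \<exists>j\<ge>J. j \<in> A \<and> w \<in> list_cyl (u j)"
    by (rule null_set_limsup_cylinders[OF N]) (rule that)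
  define wt where "wt j = of_bool (j \<in> A) * (1/2 :: real) ^ length (u j)" for j
  define c where "c = CARD('j)"
  \<comment> \<open>A bound above every position that the cylinder of \<open>u j\<close> reads in a
    component.\<close>
  define M where "M j = Suc (\<Sum>n<length (u j). pos n)" for j
  have M: "pos n < M j" if "n < length (u j)" for n j
    using member_le_sum[of n "{..<length (u j)}" pos] that by (simp add: M_def)
  define \<epsilon> :: "nat \<Rightarrow> nat \<Rightarrow> real" where "\<epsilon> k l = (1/2) ^ (k + 2) / 2 ^ (Suc k * c + c * l)" for k l
  \<comment> \<open>The demand \<open>k \<le> J\<close> later bounds the stages \<open>k\<close>
    with \<open>J k \<le> j\<close>, so that a greatest one exists.\<close>
  have "\<exists>J\<ge>k. \<forall>n. sum wt {J..<n} \<le> \<epsilon> k l" for k l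
  proof -
    have "\<epsilon> k l > 0" by (simp add: \<epsilon>_def)
    then obtain J where J: "\<And>m n. m \<ge> J \<Longrightarrow> norm (sum wt {m..<n}) < \<epsilon> k l"
      using sm unfolding summable_Cauchy wt_def[symmetric] by meson
    have "sum wt {max J k..<n} \<le> \<epsilon> k l" for n
      using J[of "max J k" n] by simp
    then show ?thesis by (intro exI[of _ "max J k"]) auto
  qed
  then obtain Jf where Jf: "\<And>k l. k \<le> Jf k l" "\<And>k l n. sum wt {Jf k l..<n} \<le> \<epsilon> k l"
    by metis
  \<comment> \<open>Levels and thresholds alternate: \<open>J k\<close> depends on
    \<open>lv k\<close>, since its tail bound must absorb \<open>2 ^ (c * lv k)\<close>; then
    \<open>lv (Suc k)\<close> is put beyond all positions read by cylinders with index below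
    \<open>J k\<close>.\<close>
  define lv where "lv = rec_nat 0 (\<lambda>k l. Suc (l + (\<Sum>j<Jf k l. M j)))"
  define J where "J k = Jf k (lv k)" for k
  have lv_Suc: "lv (Suc k) = Suc (lv k + (\<Sum>j<J k. M j))" for k
    by (simp add: lv_def J_def)
  have lv_mono: "strict_mono lv"
    by (rule strict_mono_Suc_iff[THEN iffD2]) (simp add: lv_Suc)
  have M_lv: "M j \<le> lv (Suc k)" if "j < J k" for j k
    using member_le_sum[of j "{..<J k}" M] that by (simp add: lv_Suc)
  \<comment> \<open>Positions from \<open>lv k\<close> up to \<open>lv (Suc k)\<close> look at
    exactly the first \<open>k\<close> entries of the branch index.\<close>
  define \<kappa> where "\<kappa> p = (LEAST k. p < lv (Suc k))" for p
  have \<kappa>: "p < lv (Suc (\<kappa> p))" for p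
    unfolding \<kappa>_def by (rule LeastI[of _ p]) (use strict_mono_imp_increasing[OF lv_mono, of "Suc p"] in simp)
  have \<kappa>_ge: "k \<le> \<kappa> p" if "lv k \<le> p" for k p
  proof -
    have "lv k < lv (Suc (\<kappa> p))" using \<kappa>[of p] that by simp
    then show ?thesis using lv_mono by (simp add: strict_mono_less)
  qed
  have \<kappa>_le: "\<kappa> p \<le> k" if "p < lv (Suc k)" for k p
    unfolding \<kappa>_def using that by (rule Least_le)
  \<comment> \<open>The words have one entry more than is needed to split: cylinders below
    \<open>J (Suc k)\<close> read positions below \<open>lv (Suc (Suc k))\<close>, where
    \<open>\<kappa>\<close> may reach \<open>Suc k\<close>.\<close>
  define S where "S k = {s :: 'j \<Rightarrow> bool list. (\<forall>i. length (s i) = Suc k) \<and> inj (\<lambda>i. take k (s i))}" for k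
  have S: "finite (S k)" "card (S k) \<le> 2 ^ (Suc k * c)" for k
    unfolding S_def c_def by (rule card_split_nodes)+
  define D where "D j s = {z. \<forall>n<length (u j). z (to_nat (take (\<kappa> (pos n)) (s (col n)), pos n)) = u j ! n}"
    for j and s :: "'j \<Rightarrow> bool list"
  have D: "D j s \<in> sets borel" "measure coin (D j s) \<le> 2 ^ (c * lv k) * (1/2) ^ length (u j)"
    if "s \<in> S k" for j s k
    unfolding D_def c_def
    by (rule measure_random_branch_cylinder[OF inj _ \<kappa>_ge, of k]; use that in \<open>simp add: S_def\<close>)+
  define I where "I k = {J k..<J (Suc k)} \<inter> A" for k
  define E where "E k = (\<Union>j\<in>I k. \<Union>s\<in>S k. D j s)" for k
  have Ds: "(\<Union>s\<in>S k. D j s) \<in> sets coin" for j k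
    using S D by (intro sets.finite_UN) auto
  have E_sets: "E k \<in> sets coin" for k
    unfolding E_def by (rule sets.finite_UN) (use Ds in \<open>simp_all add: I_def\<close>)
  have E_measure: "measure coin (E k) \<le> (1/2) ^ (k + 2)" for k
  proof -
    have "measure coin (E k) \<le> (\<Sum>j\<in>I k. measure coin (\<Union>s\<in>S k. D j s))"
      unfolding E_def by (rule coin.finite_measure_subadditive_finite) (use Ds in \<open>auto simp: I_def\<close>)
    also have "\<dots> \<le> (\<Sum>j\<in>I k. 2 ^ (Suc k * c) * (2 ^ (c * lv k) * (1/2) ^ length (u j)))"
    proof (rule sum_mono)
      fix j
      have "measure coin (\<Union>s\<in>S k. D j s) \<le> (\<Sum>s\<in>S k. measure coin (D j s))"
        by (rule coin.finite_measure_subadditive_finite) (use S D in auto)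
      also have "\<dots> \<le> card (S k) * (2 ^ (c * lv k) * (1/2) ^ length (u j))"
        using D(2) by (rule sum_bounded_above)
      also have "\<dots> \<le> 2 ^ (Suc k * c) * (2 ^ (c * lv k) * (1/2) ^ length (u j))"
      proof (rule mult_right_mono)
        have "real (card (S k)) \<le> real (2 ^ (Suc k * c))" using S(2) of_nat_le_iff by blast
        then show "real (card (S k)) \<le> 2 ^ (Suc k * c)" by simp
      qed simp
      finally show "measure coin (\<Union>s\<in>S k. D j s)
          \<le> 2 ^ (Suc k * c) * (2 ^ (c * lv k) * (1/2) ^ length (u j))" .
    qed
    also have "\<dots> = 2 ^ (Suc k * c + c * lv k) * (\<Sum>j\<in>I k. (1/2) ^ length (u j))"
      by (simp add: sum_distrib_left power_add mult.assoc)
    also have "(\<Sum>j\<in>I k. (1/2) ^ length (u j)) = sum wt {J k..<J (Suc k)}"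
      by (rule sum.mono_neutral_cong_left) (auto simp: I_def wt_def)
    also have "2 ^ (Suc k * c + c * lv k) * \<dots> \<le> 2 ^ (Suc k * c + c * lv k) * \<epsilon> k (lv k)"
      using Jf(2) by (intro mult_left_mono) (auto simp: J_def)
    also have "\<dots> = (1/2) ^ (k + 2)" by (simp add: \<epsilon>_def)
    finally show ?thesis .
  qed
  have "measure coin (\<Union>k. E k) \<le> (\<Sum>k. measure coin (E k))"
  proof (rule coin.finite_measure_subadditive_countably)
    show "range E \<subseteq> sets coin" using E_sets by auto
    show "summable (\<lambda>k. measure coin (E k))"
      by (rule summable_comparison_test[of _ "\<lambda>k. (1/2) ^ (k + 2)"])
        (use E_measure in \<open>auto intro!: exI[of _ 0] summable_ignore_initial_segment summable_geometric\<close>)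
  qed
  also have "\<dots> \<le> (\<Sum>k. (1/2) * (1/2) ^ Suc k)"
  proof (rule suminf_le)
    show sm': "summable (\<lambda>k. (1/2 :: real) * (1/2) ^ Suc k)"
      by (auto intro!: summable_mult summable_geometric)
    show "measure coin (E k) \<le> (1/2) * (1/2) ^ Suc k" for k using E_measure[of k] by simp
    then show "summable (\<lambda>k. measure coin (E k))"
      by (intro summable_comparison_test[OF _ sm']) auto
  qed
  also have "\<dots> = 1/2 * 1"
    using sums_mult[OF power_half_series, of "1/2"] by (rule sums_unique[symmetric])
  finally have "(\<Union>k. E k) \<noteq> UNIV" using measure_coin_UNIV by auto
  then obtain z where z: "\<And>k. z \<notin> E k" by blast
  define \<psi> where "\<psi> = random_branch \<kappa> z"
  have "(\<lambda>n. \<psi> (t (col n)) (pos n)) \<notin> N" if t: "inj t" for t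
  proof
    define w where "w = (\<lambda>n. \<psi> (t (col n)) (pos n))"
    assume "(\<lambda>n. \<psi> (t (col n)) (pos n)) \<in> N"
    then have "w \<in> N" by (simp add: w_def)
    obtain k0 where k0: "\<And>k. k0 \<le> k \<Longrightarrow> inj (\<lambda>i. map (t i) [0..<k])"
      using eventually_split[OF t] by metis
    obtain j where j: "J k0 \<le> j" "j \<in> A" "w \<in> list_cyl (u j)"
      using io[OF \<open>w \<in> N\<close>] by blast
    \<comment> \<open>\<open>J\<close> need not be monotone. The greatest stage satisfying
      \<open>P\<close> has \<open>j < J (Suc k)\<close>, so its block contains
      \<open>j\<close>.\<close>
    define P where "P k \<longleftrightarrow> k0 \<le> k \<and> J k \<le> j" for k
    have "k \<le> J k" for k using Jf(1) by (simp add: J_def)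
    then have bound: "k \<le> j" if "P k" for k using that unfolding P_def by (meson order_trans)
    have "P k0" using j by (simp add: P_def)
    define k where "k = (GREATEST k. P k)"
    have "P k" unfolding k_def using \<open>P k0\<close> bound by (rule GreatestI_nat)
    have "\<not> P (Suc k)"
      using Greatest_le_nat[of P "Suc k" j] bound unfolding k_def by fastforce
    with \<open>P k\<close> have k: "k0 \<le> k" "J k \<le> j" "j < J (Suc k)" by (auto simp: P_def)
    define s where "s i = map (t i) [0..<Suc k]" for i
    have "s \<in> S k"
      using k0[OF k(1)] by (simp add: S_def s_def take_map del: upt_Suc)
    moreover have "z \<in> D j s"
      unfolding D_def
    proof (intro CollectI allI impI)
      fix n assume n: "n < length (u j)"
      have "pos n < lv (Suc (Suc k))" using M[OF n] M_lv[OF k(3)] by simp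
      then have "\<kappa> (pos n) \<le> Suc k" by (rule \<kappa>_le)
      then have "take (\<kappa> (pos n)) (s (col n)) = map (t (col n)) [0..<\<kappa> (pos n)]"
        by (simp add: s_def take_map del: upt_Suc)
      moreover have "w n = u j ! n" using j(3) n by (simp add: list_cyl_def cyl_def)
      ultimately show "z (to_nat (take (\<kappa> (pos n)) (s (col n)), pos n)) = u j ! n"
        by (simp add: w_def \<psi>_def random_branch_def)
    qed
    ultimately have "z \<in> E k" using k j(2) by (auto simp: E_def I_def)
    with z show False by blast
  qed
  moreover have "continuous_on UNIV \<psi>" unfolding \<psi>_def by (rule continuous_random_branch)
  ultimately show ?thesis by blast
qed

section \<open>Perfect free subsets\<close>

definition pair_index :: "'m::finite option \<times> nat \<Rightarrow> nat" where
  "pair_index = to_nat_on UNIV"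

lemma bij_pair_index: "bij (pair_index :: 'm::finite option \<times> nat \<Rightarrow> nat)"
  unfolding pair_index_def by (rule to_nat_on_infinite) (simp_all add: finite_prod)

text \<open>The \<open>Some\<close> components serve as arguments and the \<open>None\<close>
  component as the value.\<close>

definition component :: "(nat \<Rightarrow> bool) \<Rightarrow> 'm::finite option \<Rightarrow> nat \<Rightarrow> bool" where
  "component w i p = w (pair_index (i, p))"

lemma continuous_component: "continuous_on UNIV (\<lambda>w. component w i)"
  unfolding component_def by (rule continuous_reindex)

text \<open>The bits outside the \<open>None\<close> component fix the arguments and thereby the
  value, while the \<open>None\<close> component itself has infinitely many bits. The map
  \<open>\<sigma>\<close> permits repeated and permuted arguments.\<close>

lemma component_graph_null:
  fixes G :: "('m::finite \<Rightarrow> nat \<Rightarrow> bool) \<Rightarrow> (nat \<Rightarrow> bool) \<Rightarrow> bool" and \<sigma> :: "'m \<Rightarrow> 'm"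
  assumes "\<And>x y y'. G x y \<Longrightarrow> G x y' \<Longrightarrow> y = y'"
    and "{w. G (\<lambda>i. component w (Some (\<sigma> i))) (component w (None :: 'm option))} \<in> sets (completion coin)"
  shows "{w. G (\<lambda>i. component w (Some (\<sigma> i))) (component w (None :: 'm option))} \<in> null_sets (completion coin)"
    (is "?N \<in> _")
proof (rule null_if_determined_off_infinite)
  let ?S = "range (\<lambda>p. pair_index (None :: 'm option, p))"
  have inj: "inj (pair_index :: 'm option \<times> nat \<Rightarrow> nat)" using bij_pair_index bij_is_inj by blast
  show "infinite ?S"
    by (intro range_inj_infinite injI) (use inj in \<open>auto dest: injD\<close>)
  fix w w' assume w: "w \<in> ?N" "w' \<in> ?N" and eq: "\<And>n. n \<notin> ?S \<Longrightarrow> w n = w' n"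
  have Some: "component w (Some i) = component w' (Some i)" for i :: 'm
  proof
    fix p
    have "pair_index (Some i, p) \<notin> ?S" using inj by (auto dest: injD)
    then show "component w (Some i) p = component w' (Some i) p"
      using eq by (simp add: component_def)
  qed
  then have None: "component w (None :: 'm option) = component w' (None :: 'm option)"
    using w by (intro assms(1)[of "\<lambda>i. component w' (Some (\<sigma> i))"]) auto
  show "w = w'"
  proof
    fix n
    obtain i p where "n = pair_index (i :: 'm option, p)"
      using bij_pair_index by (metis bij_pointE prod.collapse)
    then have "w n = component w i p" "w' n = component w' i p" by (simp_all add: component_def)
    with Some None show "w n = w' n" by (cases i) auto
  qed
qed (rule assms(2))

lemma infinite_UNIV_cantor: "infinite (UNIV :: (nat \<Rightarrow> bool) set)"
proof -
  have "inj (\<lambda>n i. i = (n :: nat))" by (auto simp: inj_def fun_eq_iff)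
  from range_inj_infinite[OF this] show ?thesis
    using finite_subset[OF subset_UNIV] by metis
qed

lemma extend_to_injective_tuple:
  fixes A :: "'a set"
  assumes "infinite (UNIV :: 'a set)" "finite A" "card A \<le> CARD('m)" "t \<notin> A"
  obtains b :: "'m::finite \<Rightarrow> 'a" where "inj b" "A \<subseteq> range b" "t \<notin> range b"
proof -
  have "infinite (UNIV - insert t A)" using assms by (intro Diff_infinite_finite) auto
  then obtain B where B: "finite B" "card B = CARD('m) - card A" "B \<subseteq> UNIV - insert t A"
    using infinite_arbitrarily_large by blast
  have "card (A \<union> B) = CARD('m)"
    using B assms by (subst card_Un_disjoint) auto
  then obtain b :: "'m \<Rightarrow> 'a" where "bij_betw b UNIV (A \<union> B)"
    using finite_same_card_bij[of "UNIV :: 'm set" "A \<union> B"] assms(2) B(1) by auto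
  then show ?thesis
    using that[of b] B(3) assms(4) by (auto simp: bij_betw_def)
qed

text \<open>Avoiding the graphs \<open>NG \<sigma>\<close> for all \<open>\<sigma>\<close> lets
  injective tuples account for tuples with repetitions. Avoiding the diagonals \<open>ND j\<close>
  makes \<open>\<psi>\<close> injective.\<close>

lemma null_graph_free_branches:
  fixes G :: "('m::finite \<Rightarrow> nat \<Rightarrow> bool) \<Rightarrow> (nat \<Rightarrow> bool) \<Rightarrow> bool"
  assumes func: "\<And>x y y'. G x y \<Longrightarrow> G x y' \<Longrightarrow> y = y'"
    and meas: "\<And>\<sigma> :: 'm \<Rightarrow> 'm. {w. G (\<lambda>i. component w (Some (\<sigma> i))) (component w (None :: 'm option))} \<in> sets (completion coin)"
  shows "\<exists>\<psi> :: (nat \<Rightarrow> bool) \<Rightarrow> nat \<Rightarrow> bool. continuous_on UNIV \<psi> \<and> inj \<psi> \<and>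
    (\<forall>a y. (\<forall>i. a i \<in> range \<psi>) \<longrightarrow> y \<in> range \<psi> \<longrightarrow> G a y \<longrightarrow> y \<in> range a)"
proof -
  define NG where "NG = (\<lambda>\<sigma> :: 'm \<Rightarrow> 'm. {w. G (\<lambda>i. component w (Some (\<sigma> i))) (component w (None :: 'm option))})"
  define ND where "ND = (\<lambda>j :: 'm. {w. component w (None :: 'm option) = component w (Some j)})"
  have "NG \<sigma> \<in> null_sets (completion coin)" for \<sigma>
    unfolding NG_def using func meas by (rule component_graph_null)
  moreover have "ND j \<in> null_sets (completion coin)" for j
  proof -
    have "closed (ND j)"
      unfolding ND_def by (intro closed_Collect_eq continuous_component)
    then have "ND j \<in> sets (completion coin)" by simp
    \<comment> \<open>The diagonal is the graph of a projection: the constant map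
      \<open>\<lambda>_. j\<close> makes every argument the \<open>j\<close>-th component, whichever
      index \<open>undefined\<close> denotes.\<close>
    then show ?thesis
      unfolding ND_def
      using component_graph_null[of "\<lambda>x y. y = x undefined" "\<lambda>_. j"] by simp
  qed
  ultimately have N: "(\<Union>\<sigma>. NG \<sigma>) \<union> (\<Union>j. ND j) \<in> null_sets (completion coin)"
    by (intro null_sets.Un null_sets_UN' countable_finite) auto
  define ix where "ix = inv (pair_index :: 'm option \<times> nat \<Rightarrow> nat)"
  have ix: "ix (pair_index q) = q" for q
    unfolding ix_def by (rule inv_f_f[OF bij_is_inj[OF bij_pair_index]])
  have "inj ix" unfolding ix_def using bij_pair_index bij_imp_bij_inv bij_is_inj by blast
  then have inj: "inj (\<lambda>n. (fst (ix n), snd (ix n)))" by simp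
  have "\<exists>\<psi> :: (nat \<Rightarrow> bool) \<Rightarrow> nat \<Rightarrow> bool. continuous_on UNIV \<psi> \<and>
      (\<forall>T. inj T \<longrightarrow> (\<lambda>n. \<psi> (T (fst (ix n))) (snd (ix n))) \<notin> (\<Union>\<sigma>. NG \<sigma>) \<union> (\<Union>j. ND j))"
    by (rule mycielski_null[OF inj N])
  then obtain \<psi> :: "(nat \<Rightarrow> bool) \<Rightarrow> nat \<Rightarrow> bool" where \<psi>: "continuous_on UNIV \<psi>"
    "\<And>T. inj T \<Longrightarrow> (\<lambda>n. \<psi> (T (fst (ix n))) (snd (ix n))) \<notin> (\<Union>\<sigma>. NG \<sigma>) \<union> (\<Union>j. ND j)"
    by blast
  have comp: "component (\<lambda>n. \<psi> (T (fst (ix n))) (snd (ix n))) i = \<psi> (T i)" for T and i :: "'m option"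
    by (auto simp: component_def ix)
  have avoid: "\<not> G (\<lambda>i. \<psi> (b (\<sigma> i))) (\<psi> t)" "\<psi> t \<noteq> \<psi> (b j)"
    if "inj b" "t \<notin> range b" for b :: "'m \<Rightarrow> nat \<Rightarrow> bool" and t \<sigma> j
  proof -
    have "inj (case_option t b)"
      using that by (auto simp: inj_def split: option.splits)
    from \<psi>(2)[OF this] show "\<not> G (\<lambda>i. \<psi> (b (\<sigma> i))) (\<psi> t)" "\<psi> t \<noteq> \<psi> (b j)"
      unfolding NG_def ND_def by (auto simp: comp)
  qed
  have "inj \<psi>"
  proof (rule injI, rule ccontr)
    fix t t' assume eq: "\<psi> t = \<psi> t'" and "t \<noteq> t'"
    have "card {t'} \<le> CARD('m)" by (simp add: Suc_le_eq)
    then obtain b :: "'m \<Rightarrow> nat \<Rightarrow> bool" where b: "inj b" "{t'} \<subseteq> range b" "t \<notin> range b"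
      using extend_to_injective_tuple[OF infinite_UNIV_cantor, of "{t'}" t] \<open>t \<noteq> t'\<close> by auto
    then obtain j where "t' = b j" by auto
    with avoid(2)[OF b(1,3), of j] eq show False by simp
  qed
  moreover have "y \<in> range a"
    if a: "\<And>i. a i \<in> range \<psi>" and y: "y \<in> range \<psi>" and G: "G a y" for a y
  proof (rule ccontr)
    assume ny: "y \<notin> range a"
    have "\<forall>i. \<exists>s. a i = \<psi> s" using a by blast
    then obtain \<tau> where \<tau>: "\<And>i. a i = \<psi> (\<tau> i)" by metis
    obtain t where t: "y = \<psi> t" using y by blast
    have "t \<notin> range \<tau>" using ny \<tau> t by auto
    moreover have "card (range \<tau>) \<le> CARD('m)" by (rule card_image_le) simp
    ultimately obtain b :: "'m \<Rightarrow> nat \<Rightarrow> bool" where b: "inj b" "range \<tau> \<subseteq> range b" "t \<notin> range b"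
      using extend_to_injective_tuple[OF infinite_UNIV_cantor, of "range \<tau>" t] by auto
    have "\<forall>i. \<exists>j. \<tau> i = b j" using b(2) by blast
    then obtain \<sigma> where \<sigma>: "\<And>i. \<tau> i = b (\<sigma> i)" by metis
    have "a = (\<lambda>i. \<psi> (b (\<sigma> i)))" using \<tau> \<sigma> by auto
    with avoid(1)[OF b(1,3)] G t show False by simp
  qed
  ultimately show ?thesis using \<psi>(1) by blast
qed

section \<open>Perfect sets as injective continuous images\<close>

lemma compact_cantor: "compact (UNIV :: (nat \<Rightarrow> bool) set)"
proof -
  have "compact_space (euclidean :: bool topology)"
    by (simp add: compact_space_def finite_imp_compact)
  then have "compact_space (product_topology (\<lambda>_::nat. euclidean :: bool topology) UNIV)"
    by (simp add: compact_space_product_topology)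
  then show ?thesis
    by (simp add: euclidean_product_topology compact_space_def)
qed

text \<open>Compactness gives closedness. Flipping one late bit of a parameter yields a different
  point nearby, by injectivity and continuity.\<close>

lemma perfect_range:
  fixes \<psi> :: "(nat \<Rightarrow> bool) \<Rightarrow> 'a::t2_space"
  assumes \<psi>: "continuous_on UNIV \<psi>" "inj \<psi>"
  shows "closed (range \<psi>)" and "x \<in> range \<psi> \<Longrightarrow> x islimpt range \<psi>"
proof -
  show "closed (range \<psi>)"
    by (intro compact_imp_closed compact_continuous_image \<psi> compact_cantor)
  assume "x \<in> range \<psi>"
  then obtain t where t: "x = \<psi> t" by auto
  show "x islimpt range \<psi>"
  proof (rule islimptI)
    fix U assume U: "x \<in> U" "open U"
    then have "open (\<psi> -` U)" "t \<in> \<psi> -` U" using \<psi>(1) t by (auto simp: continuous_on_open_vimage)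
    then obtain k where k: "cyl k t \<subseteq> \<psi> -` U" by (rule open_contains_cyl)
    have "flip k t \<in> cyl k t" by (simp add: cyl_def)
    moreover have "flip k t \<noteq> t" by (metis flip_same)
    ultimately show "\<exists>y\<in>range \<psi>. y \<in> U \<and> y \<noteq> x"
      using k t \<psi>(2) by (intro bexI[of _ "\<psi> (flip k t)"]) (auto dest: injD)
  qed
qed

section \<open>Projective sets of binary sequences and of reals\<close>

lemma cantor_surjection:
  defines "p \<equiv> \<lambda>w i. (w :: nat \<Rightarrow> nat) i > 0"
  shows "continuous_on UNIV p" and "surj p"
proof -
  show "continuous_on UNIV p"
    unfolding p_def
  proof (intro continuous_on_coordinatewise_then_product continuous_on_cylI)
    fix i and x :: "nat \<Rightarrow> nat" and U :: "bool set" assume "(x i > 0) \<in> U"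
    then show "\<exists>k. \<forall>w\<in>cyl k x. (w i > 0) \<in> U"
      by (intro exI[of _ "Suc i"]) (auto simp: cyl_def)
  qed
  have "p (\<lambda>i. of_bool (y i)) = y" for y by (auto simp: p_def)
  then show "surj p" by (rule surjI[where f = "\<lambda>y i. of_bool (y i)"])
qed

lemma continuous_first: "continuous_on UNIV (\<lambda>w :: nat \<Rightarrow> nat. g (w 0) :: 'a::topological_space)"
  by (rule continuous_on_cylI) (auto simp: cyl_def intro!: exI[of _ 1])

text \<open>The first entry codes the integer part; the signs of the later entries are the binary
  digits of the fractional part.\<close>

lemma real_surjection:
  obtains q :: "(nat \<Rightarrow> nat) \<Rightarrow> real" where "continuous_on UNIV q" "surj q"
proof
  define q where "q w = real_of_int (int_decode (w 0)) + binval (\<lambda>i. w (Suc i) > 0)" for w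
  show "continuous_on UNIV q"
    unfolding q_def
    using continuous_on_compose_UNIV[OF cantor_surjection(1) continuous_reindex[of Suc]]
    by (intro continuous_on_add continuous_first continuous_on_compose_UNIV[OF continuous_binval])
  have "q (case_nat (int_encode \<lfloor>x\<rfloor>) (\<lambda>i. of_bool (bindigits (frac x) i))) = x" for x
    using binval_bindigits[of "frac x"] frac_lt_1[of x]
    by (simp add: q_def) (simp add: frac_def)
  then show "surj q"
    by (rule surjI[where f = "\<lambda>x. case_nat (int_encode \<lfloor>x\<rfloor>) (\<lambda>i. of_bool (bindigits (frac x) i))"])
qed

lemma open_real_boldSigma:
  assumes "open (U :: real set)"
  shows "U \<in> boldSigma (Suc k)"
proof -
  obtain q :: "(nat \<Rightarrow> nat) \<Rightarrow> real" where q: "continuous_on UNIV q" "surj q"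
    by (rule real_surjection)
  have "open (q -` U)" using q(1) assms by (simp add: continuous_on_open_vimage)
  then have "q ` (q -` U) \<in> boldSigma (Suc k)"
    using q(1) by (intro boldSigma_image open_baire_boldSigma clopen_baire_Pi)
  then show ?thesis using q(2) by (simp add: surj_image_vimage_eq)
qed

lemma rationals_enum:
  obtains r :: "nat \<Rightarrow> real" where "range r = \<rat>"
  using range_from_nat_into[of "\<rat> :: real set"] countable_rat Rats_0 by (metis empty_iff)

lemma rationals_boldSigma: "(\<rat> :: real set) \<in> boldSigma (Suc k)"
proof -
  obtain r :: "nat \<Rightarrow> real" where r: "range r = \<rat>" by (rule rationals_enum)
  have "(\<lambda>w :: nat \<Rightarrow> nat. r (w 0)) ` UNIV \<in> boldSigma (Suc k)"
    by (intro closed_image_boldSigma closed_UNIV continuous_first)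
  moreover have "r n \<in> (\<lambda>w :: nat \<Rightarrow> nat. r (w 0)) ` UNIV" for n
    by (rule image_eqI[of _ _ "\<lambda>_. n"]) auto
  then have "(\<lambda>w :: nat \<Rightarrow> nat. r (w 0)) ` UNIV = range r" by auto
  ultimately show ?thesis by (simp add: r)
qed

text \<open>A code carries, besides the real, a lower bound for its distance to each rational. With
  these witnesses irrationality becomes a closed condition.\<close>

lemma irrationals_boldSigma: "- (\<rat> :: real set) \<in> boldSigma (Suc k)"
proof -
  obtain r :: "nat \<Rightarrow> real" where r: "range r = \<rat>" by (rule rationals_enum)
  obtain q :: "(nat \<Rightarrow> nat) \<Rightarrow> real" where q: "continuous_on UNIV q" "surj q"
    by (rule real_surjection)
  have qe: "continuous_on UNIV (\<lambda>w. q (evens w))"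
    by (rule continuous_on_compose_UNIV[OF q(1) continuous_reindex])
  define C where "C = {w. \<forall>n. inverse (real (Suc (odds w n))) \<le> \<bar>q (evens w) - r n\<bar>}"
  have inv: "continuous_on UNIV (\<lambda>w :: nat \<Rightarrow> nat. inverse (real (Suc (w m))))" for m
    using continuous_on_compose_UNIV[OF continuous_first[of "\<lambda>x. inverse (real (Suc x))"]
        continuous_reindex[of "\<lambda>_. m"]] by simp
  have "closed C"
    unfolding C_def
    by (intro closed_Collect_all closed_Collect_le inv continuous_intros qe)
  then have "(\<lambda>w. q (evens w)) ` C \<in> boldSigma (Suc k)"
    using qe by (rule closed_image_boldSigma)
  moreover have "(\<lambda>w. q (evens w)) ` C = - \<rat>"
  proof (intro equalityI subsetI)
    fix x assume "x \<in> (\<lambda>w. q (evens w)) ` C"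
    then obtain w where w: "x = q (evens w)" "w \<in> C" by auto
    have "x \<noteq> r n" for n
    proof -
      have "inverse (real (Suc (odds w n))) \<le> \<bar>x - r n\<bar>" using w by (auto simp: C_def)
      moreover have "0 < inverse (real (Suc (odds w n)))" by simp
      ultimately show ?thesis by auto
    qed
    then show "x \<in> - \<rat>" using r by auto
  next
    fix x assume x: "x \<in> - (\<rat> :: real set)"
    have "\<exists>m. inverse (real (Suc m)) \<le> \<bar>x - r n\<bar>" for n
    proof -
      have "\<bar>x - r n\<bar> > 0" using x r by auto
      then show ?thesis using reals_Archimedean less_imp_le by blast
    qed
    then obtain m where m: "\<And>n. inverse (real (Suc (m n))) \<le> \<bar>x - r n\<bar>" by metis
    obtain v where v: "x = q v" using q(2) by auto
    obtain w where "evens w = v" "odds w = m" by (rule obtain_interleave)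
    with m v show "x \<in> (\<lambda>w. q (evens w)) ` C"
      by (intro image_eqI[of _ _ w]) (simp_all add: C_def fun_eq_iff)
  qed
  ultimately show ?thesis by simp
qed

text \<open>By injectivity of \<open>binval\<close> off the rationals, the complement of the set
  consists of the image of \<open>- E\<close>, the rationals and the reals outside the closed range
  of \<open>binval\<close>.\<close>

lemma binval_image_boldDelta:
  assumes "E \<in> boldDelta (Suc k)"
  shows "binval ` E - \<rat> \<in> boldDelta (Suc k)"
proof -
  have E: "binval ` E \<in> boldSigma (Suc k)" "binval ` (- E) \<in> boldSigma (Suc k)"
    using assms continuous_binval by (auto simp: boldDelta_def boldPi_def intro: boldSigma_image)
  have "closed (range binval)"
    by (intro compact_imp_closed compact_continuous_image continuous_binval compact_cantor)
  then have "- range binval \<in> boldSigma (Suc k)"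
    by (intro open_real_boldSigma) auto
  moreover have "- (binval ` E - \<rat>) = binval ` (- E) \<union> \<rat> \<union> - range binval"
  proof -
    have "y \<in> E" if "binval y \<notin> \<rat>" "x \<in> E" "binval x = binval y" for x y
      using that binval_eq_cases by metis
    then show ?thesis by auto
  qed
  ultimately have "- (binval ` E - \<rat>) \<in> boldSigma (Suc k)"
    using E(2) rationals_boldSigma boldSigma_Un by metis
  moreover have "binval ` E - \<rat> \<in> boldSigma (Suc k)"
    using boldSigma_Int[OF E(1) irrationals_boldSigma] by (simp add: Diff_eq)
  ultimately show ?thesis by (simp add: boldDelta_def boldPi_def)
qed

section \<open>The two halves of the theorem\<close>

lemma cantor_boldSigma_vimage:
  fixes h :: "(nat \<Rightarrow> bool) \<Rightarrow> 'a::t2_space"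
  assumes "A \<in> boldSigma (Suc k)" "continuous_on UNIV h"
  shows "h -` A \<in> boldSigma (Suc k)"
  using assms cantor_surjection by (rule boldSigma_vimage)

text \<open>The graph is measured bit by bit: agreement of the \<open>p\<close>-th bits of value and
  \<open>None\<close> component is a Boolean combination of \<open>F p\<close> and
  \<open>V p\<close>, and the graph is the countable intersection over \<open>p\<close>.\<close>

lemma perfect_free_subset_Delta:
  fixes f :: "('m::finite \<Rightarrow> (nat \<Rightarrow> bool)) \<Rightarrow> (nat \<Rightarrow> bool)"
  assumes leb: "\<And>A :: real set. A \<in> boldDelta (Suc k) \<Longrightarrow> A \<in> sets lebesgue"
    and f: "Delta_function (Suc k) f"
  shows "has_perfect_free_subset f"
proof -
  have "{w. f (\<lambda>i. component w (Some (\<sigma> i))) = component w (None :: 'm option)} \<in> sets (completion coin)"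
    for \<sigma> :: "'m \<Rightarrow> 'm"
  proof -
    define h where "h w = (\<lambda>i. component w (Some (\<sigma> i)))" for w
    have h: "continuous_on UNIV h"
      unfolding h_def by (intro continuous_on_coordinatewise_then_product continuous_component)
    have vimage: "h -` A \<in> boldDelta (Suc k)" if "A \<in> boldDelta (Suc k)" for A
      using that cantor_boldSigma_vimage[OF _ h, of A] cantor_boldSigma_vimage[OF _ h, of "- A"]
      by (simp add: boldDelta_def boldPi_def vimage_Compl)
    define F where "F p = {w. f (h w) p}" for p
    define V where "V p = {w. component w (None :: 'm option) p}" for p
    have F: "F p \<in> sets (completion coin)" for p
    proof -
      have "open {y :: nat \<Rightarrow> bool. y p}"
        using open_vimage[of "{True}" "\<lambda>y :: nat \<Rightarrow> bool. y p"] by (simp add: open_discrete vimage_def)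
      then have "f -` {y. y p} \<in> boldDelta (Suc k)" using f unfolding Delta_function_def by blast
      then have "h -` f -` {y. y p} \<in> boldDelta (Suc k)" by (rule vimage)
      then have "F p \<in> boldDelta (Suc k)" by (simp add: F_def vimage_def)
      then show ?thesis
        by (intro completion_coin_transfer leb binval_image_boldDelta)
    qed
    have V: "V p \<in> sets (completion coin)" for p
      using borel_coordinate[of "pair_index (None :: 'm option, p)" True]
      by (simp add: V_def component_def)
    have "{w. f (h w) = component w (None :: 'm option)} =
        (\<Inter>p. (F p \<inter> V p) \<union> ((space (completion coin) - F p) \<inter> (space (completion coin) - V p)))"
      by (auto simp: fun_eq_iff F_def V_def)
    also have "\<dots> \<in> sets (completion coin)"
      using F V by (intro sets.countable_INT'' sets.Un sets.Int sets.compl_sets) auto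
    finally show ?thesis by (simp add: h_def)
  qed
  then obtain \<psi> :: "(nat \<Rightarrow> bool) \<Rightarrow> nat \<Rightarrow> bool" where \<psi>: "continuous_on UNIV \<psi>" "inj \<psi>"
    and free: "\<forall>a y. (\<forall>i. a i \<in> range \<psi>) \<longrightarrow> y \<in> range \<psi> \<longrightarrow> f a = y \<longrightarrow> y \<in> range a"
    using null_graph_free_branches[of "\<lambda>a y. f a = y"] by auto
  have "free_for f (range \<psi>)"
    unfolding free_for_def using free by blast
  then show ?thesis
    unfolding has_perfect_free_subset_def using perfect_range[OF \<psi>]
    by (intro exI[of _ "range \<psi>"]) auto
qed

text \<open>The hypothesis concerns the complement of the graph. That complement is pulled back to
  binary sequences and mapped to the reals by \<open>binval\<close>, both of which preserve
  \<open>boldSigma\<close>.\<close>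

lemma perfect_free_subset_Pi_graph:
  fixes f :: "('m::finite \<Rightarrow> (nat \<Rightarrow> nat)) \<Rightarrow> (nat \<Rightarrow> nat)"
  assumes leb: "\<And>A :: real set. A \<in> boldSigma (Suc k) \<Longrightarrow> A \<in> sets lebesgue"
    and f: "range (\<lambda>x. (x, f x)) \<in> boldPi (Suc k)"
  shows "has_perfect_free_subset f"
proof -
  define c :: "(nat \<Rightarrow> bool) \<Rightarrow> nat \<Rightarrow> nat" where "c y = (\<lambda>i. of_bool (y i))" for y
  have c: "continuous_on UNIV c"
    unfolding c_def
  proof (intro continuous_on_coordinatewise_then_product continuous_on_cylI)
    fix i and x :: "nat \<Rightarrow> bool" and U :: "nat set" assume "of_bool (x i) \<in> U"
    then show "\<exists>k. \<forall>w\<in>cyl k x. of_bool (w i) \<in> U"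
      by (intro exI[of _ "Suc i"]) (auto simp: cyl_def)
  qed
  have "inj c" by (auto simp: inj_def c_def fun_eq_iff)
  have meas: "{w. f (\<lambda>i. c (component w (Some (\<sigma> i)))) = c (component w (None :: 'm option))} \<in> sets (completion coin)"
    (is "?N \<in> _") for \<sigma> :: "'m \<Rightarrow> 'm"
  proof -
    define h where "h w = (\<lambda>i. c (component w (Some (\<sigma> i))), c (component w (None :: 'm option)))" for w
    have "continuous_on UNIV h"
      unfolding h_def
      by (intro continuous_on_Pair continuous_on_coordinatewise_then_product
          continuous_on_compose_UNIV[OF c] continuous_component)
    then have "h -` (- range (\<lambda>x. (x, f x))) \<in> boldSigma (Suc k)"
      using f by (intro cantor_boldSigma_vimage) (simp add: boldPi_def)
    moreover have "(x, y) \<in> range (\<lambda>x. (x, f x)) \<longleftrightarrow> f x = y" for x y by auto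
    then have "h -` (- range (\<lambda>x. (x, f x))) = - ?N"
      unfolding h_def by (intro set_eqI) (simp only: vimage_Compl Compl_iff vimage_eq mem_Collect_eq)
    ultimately have "binval ` (- ?N) \<in> sets lebesgue"
      by (intro leb boldSigma_image[OF _ continuous_binval]) simp
    moreover have "\<rat> \<in> sets (lebesgue :: real measure)"
      using countable_imp_null_set_lborel[OF countable_rat] by (auto intro: sets_completionI_sets)
    ultimately have "- ?N \<in> sets (completion coin)"
      by (intro completion_coin_transfer) auto
    then have "space (completion coin) - - ?N \<in> sets (completion coin)" by (rule sets.compl_sets)
    then show ?thesis by simp
  qed
  \<comment> \<open>Values of \<open>f\<close> may leave the range of \<open>c\<close>, so
    \<open>G\<close> is the graph of a partial function; it is single-valued because
    \<open>c\<close> is injective.\<close>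
  define G where "G a y \<longleftrightarrow> f (\<lambda>i. c (a i)) = c y" for a y
  have "y = y'" if "G x y" "G x y'" for x y y'
    using that \<open>inj c\<close> unfolding G_def by (auto dest: injD)
  then obtain \<psi> :: "(nat \<Rightarrow> bool) \<Rightarrow> nat \<Rightarrow> bool" where \<psi>: "continuous_on UNIV \<psi>" "inj \<psi>"
    and free: "\<forall>a y. (\<forall>i. a i \<in> range \<psi>) \<longrightarrow> y \<in> range \<psi> \<longrightarrow> G a y \<longrightarrow> y \<in> range a"
    using null_graph_free_branches[of G] meas unfolding G_def by auto
  define P where "P = range (\<lambda>t. c (\<psi> t))"
  have "free_for f P"
    unfolding free_for_def
  proof (intro allI impI)
    fix a :: "'m \<Rightarrow> nat \<Rightarrow> nat" assume a: "\<forall>i. a i \<in> P"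
    then have "\<forall>i. \<exists>x. a i = c x \<and> x \<in> range \<psi>" by (auto simp: P_def)
    then obtain x where x: "\<And>i. a i = c (x i)" "\<And>i. x i \<in> range \<psi>" by metis
    have "f a \<in> range a" if fa: "f a \<in> P"
    proof -
      obtain t where t: "f a = c (\<psi> t)" using fa by (auto simp: P_def)
      have "a = (\<lambda>i. c (x i))" using x(1) by auto
      with t have "G x (\<psi> t)" by (simp add: G_def)
      then have "\<psi> t \<in> range x" using free x(2) by blast
      with t x(1) show ?thesis by (metis rangeE rangeI)
    qed
    then show "f a \<in> range a \<union> - P" by blast
  qed
  moreover have "closed P" "\<forall>x\<in>P. x islimpt P"
    unfolding P_def
    using perfect_range[OF continuous_on_compose_UNIV[OF c \<psi>(1)]] inj_compose[OF \<open>inj c\<close> \<psi>(2)]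
    by (auto simp: o_def)
  ultimately show ?thesis
    unfolding has_perfect_free_subset_def by (intro exI[of _ P]) (auto simp: P_def)
qed

theorem theorem1p4:
  fixes n :: nat
  assumes "n \<ge> 1"
  shows
    "((\<forall>A :: real set. A \<in> boldDelta n \<longrightarrow> A \<in> sets lebesgue) \<longrightarrow>
        (\<forall>f :: ('m::finite \<Rightarrow> (nat \<Rightarrow> bool)) \<Rightarrow> (nat \<Rightarrow> bool).
            Delta_function n f \<longrightarrow> has_perfect_free_subset f))
   \<and> ((\<forall>A :: real set. A \<in> boldSigma n \<longrightarrow> A \<in> sets lebesgue) \<longrightarrow>
        (\<forall>f :: ('m \<Rightarrow> (nat \<Rightarrow> nat)) \<Rightarrow> (nat \<Rightarrow> nat).
            range (\<lambda>x. (x, f x)) \<in> boldPi n \<longrightarrow> has_perfect_free_subset f))"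
proof -
  obtain k where "n = Suc k" using assms by (cases n) auto
  then show ?thesis
    using perfect_free_subset_Delta perfect_free_subset_Pi_graph by blast
qed

end
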